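(* The set $\mathcal{B}=\{q^{-\frac12ab}X_m^aX_{m+1}^b\mid m\in\mathbb{Z},(a,b)\in\mathbb{Z}_{\ge0}^2\}\cup\{F_n(X_\delta)\mid n\ge1\}$ is the canonical basis of $\mathcal{A}_q(1,4)$: it is a $\mathbb{Z}[q^{\pm\frac12}]$-basis of $\mathcal{A}_q(1,4)$ and every positive element of $\mathcal{A}_q(1,4)$ is an $\mathbb{N}[q^{\pm\frac12}]$-linear combination of elements of $\mathcal{B}$.
   Context: Let $\mathcal{T}$ be the quantum torus over $\mathbb{Z}[q^{\pm\frac12}]$ generated by $X_1^{\pm1},X_2^{\pm1}$ with $X_1X_2=qX_2X_1$, with skew field of fractions $\mathcal{F}$. Define $X_k\in\mathcal{F}$ ($k\in\mathbb{Z}$) by $X_{k-1}X_{k+1}=q^{\frac12}X_k+1$ for $k$ odd and $X_{k-1}X_{k+1}=q^2X_k^4+1$ for $k$ even; $\mathcal{A}_q(1,4)$ is the $\mathbb{Z}[q^{\pm\frac12}]$-subalgebra of $\mathcal{F}$ generated by all $X_k$. Put $X^{(a,b)}=q^{-\frac12ab}X_1^aX_2^b$ and $X_\delta=X^{(-1,-2)}+X^{(-1,2)}+X^{(1,-2)}+(q^{-\frac12}+q^{\frac12})X^{(0,-2)}$. Chebyshev polynomials: $F_0=1,F_1=x,F_2=x^2-2$, $F_{n+1}=F_nx-F_{n-1}$ for $n\ge2$. An element $Y\in\mathcal{A}_q(1,4)$ is positive if for every $m\in\mathbb{Z}$ the coefficients of its Laurent expansion in the cluster variables $X_m,X_{m+1}$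 belong to $\mathbb{N}[q^{\pm\frac12}]$. A $\mathbb{Z}[q^{\pm\frac12}]$-basis $\mathcal{C}$ is called the canonical basis if every positive element is an $\mathbb{N}[q^{\pm\frac12}]$-linear combination of elements of $\mathcal{C}$. *)

theory Defs
  imports Main HOL.Modules "HOL-Library.Poly_Mapping"
begin

text \<open>Laurent polynomials in t = q^(1/2) with integer coefficients, as finitely supported
  functions int =>0 int with convolution product.  tq k is the monomial t^k = q^(k/2).\<close>

type_synonym lpoly = "int \<Rightarrow>\<^sub>0 int"

definition tq :: "int \<Rightarrow> lpoly" where
  "tq k = Poly_Mapping.single k 1"

definition lpoly_nonneg :: "lpoly \<Rightarrow> bool" where
  "lpoly_nonneg p \<longleftrightarrow> (\<forall>k. 0 \<le> Poly_Mapping.lookup p k)"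

text \<open>Elements of the quantum torus are finitely supported functions Z^2 => Z[q^(+-1/2)];
  the point (a,b) stands for the normalized monomial X^(a,b) = q^(-ab/2) X1^a X2^b.
  Multiplication: X^e X^f = q^(Lambda(e,f)/2) X^(e+f), Lambda(e,f) = e1 f2 - e2 f1,
  which encodes X1 X2 = q X2 X1.\<close>

type_synonym qtorus = "(int \<times> int) \<Rightarrow>\<^sub>0 lpoly"

definition lam :: "int \<times> int \<Rightarrow> int \<times> int \<Rightarrow> int" where
  "lam e f = fst e * snd f - snd e * fst f"

definition qmon :: "int \<times> int \<Rightarrow> qtorus" where
  "qmon e = Poly_Mapping.single e 1"

definition tmult :: "qtorus \<Rightarrow> qtorus \<Rightarrow> qtorus" (infixl \<open>\<star>\<close> 70) where
  "x \<star> y = (\<Sum>e\<in>Poly_Mapping.keys x. \<Sum>f\<in>Poly_Mapping.keys y.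
              Poly_Mapping.single (fst e + fst f, snd e + snd f) (Poly_Mapping.lookup x e * Poly_Mapping.lookup y f * tq (lam e f)))"

definition tone :: qtorus where
  "tone = qmon (0, 0)"

definition tsmul :: "lpoly \<Rightarrow> qtorus \<Rightarrow> qtorus" where
  "tsmul c x = Poly_Mapping.single (0, 0) c \<star> x"

definition tpow :: "qtorus \<Rightarrow> nat \<Rightarrow> qtorus" where
  "tpow x n = ((\<lambda>y. y \<star> x) ^^ n) tone"

definition clrec :: "(int \<Rightarrow> qtorus) \<Rightarrow> bool" where
  "clrec s \<longleftrightarrow> s 1 = qmon (1, 0) \<and> s 2 = qmon (0, 1) \<and>
     (\<forall>k::int. odd k \<longrightarrow> s (k - 1) \<star> s (k + 1) = tsmul (tq 1) (s k) + tone) \<and>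
     (\<forall>k::int. even k \<longrightarrow> s (k - 1) \<star> s (k + 1) = tsmul (tq 4) (tpow (s k) 4) + tone)"

text \<open>The cluster variables X_k (they lie in the quantum torus by the quantum Laurent
  phenomenon, and are unique there since the torus is a domain).\<close>
definition Xc :: "int \<Rightarrow> qtorus" where
  "Xc = (THE s. clrec s)"

inductive_set Aq :: "qtorus set" where
  gen: "Xc k \<in> Aq"
| one: "tone \<in> Aq"
| add: "x \<in> Aq \<Longrightarrow> y \<in> Aq \<Longrightarrow> x + y \<in> Aq"
| mult: "x \<in> Aq \<Longrightarrow> y \<in> Aq \<Longrightarrow> x \<star> y \<in> Aq"
| smul: "x \<in> Aq \<Longrightarrow> tsmul c x \<in> Aq"

definition Xdelta :: qtorus where
  "Xdelta = qmon (-1, -2) + qmon (-1, 2) + qmon (1, -2) + tsmul (tq (-1) + tq 1) (qmon (0, -2))"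

fun cheb :: "nat \<Rightarrow> qtorus \<Rightarrow> qtorus" where
  "cheb 0 x = tone"
| "cheb (Suc 0) x = x"
| "cheb (Suc (Suc 0)) x = x \<star> x - tsmul 2 tone"
| "cheb (Suc (Suc (Suc n))) x = cheb (Suc (Suc n)) x \<star> x - cheb (Suc n) x"

definition Bset :: "qtorus set" where
  "Bset = {tsmul (tq (- (int a * int b))) (tpow (Xc m) a \<star> tpow (Xc (m + 1)) b) | m a b. True}
        \<union> {cheb n Xdelta | n. n \<ge> 1}"

text \<open>Y has Laurent expansion Y = sum c_(a,b) X_m^a X_(m+1)^b (a,b in Z) in the cluster
  (X_m, X_(m+1)), an identity in the skew field of fractions.  Clearing denominators
  (multiply by X_m^N on the left and X_(m+1)^N on the right), this is equivalent to an
  identity inside the quantum torus, which embeds in its skew field of fractions.\<close>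
definition laurent_exp :: "int \<Rightarrow> ((int \<times> int) \<Rightarrow>\<^sub>0 lpoly) \<Rightarrow> qtorus \<Rightarrow> bool" where
  "laurent_exp m c Y \<longleftrightarrow> (\<exists>N::nat.
      (\<forall>(a, b)\<in>Poly_Mapping.keys c. - int N \<le> a \<and> - int N \<le> b) \<and>
      tpow (Xc m) N \<star> Y \<star> tpow (Xc (m + 1)) N =
        (\<Sum>(a, b)\<in>Poly_Mapping.keys c. tsmul (Poly_Mapping.lookup c (a, b))
            (tpow (Xc m) (nat (a + int N)) \<star> tpow (Xc (m + 1)) (nat (b + int N)))))"

definition positive :: "qtorus \<Rightarrow> bool" where
  "positive Y \<longleftrightarrow> Y \<in> Aq \<and>
     (\<forall>m::int. \<exists>c. laurent_exp m c Y \<and> (\<forall>e. lpoly_nonneg (Poly_Mapping.lookup c e)))"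

end

theory Submission
  imports Defs "HOL-Library.Product_Plus" "HOL-Library.Product_Lexorder"
begin

text \<open>
  Write \<open>t\<close> for \<open>q^(1/2)\<close>. The element \<open>X_delta\<close> makes the cluster variables of even index a linear
  recurrent sequence, \<open>X_delta X_m = t^(-1) X_(m+2) + t X_(m-2)\<close>, and \<open>t X_m\<close> with \<open>m\<close> odd is
  \<open>X_(m-1) X_(m+1) - 1\<close>; all exchange relations, and with them the Laurent phenomenon, follow from this.

  Every element of the set \<open>B\<close> is pointed: its support has a least exponent vector for the componentwise
  order, with coefficient a power of \<open>t\<close>, and every vector of \<open>Z^2\<close> occurs in this way. The standard
  monomials in \<open>X_0, X_1, X_2, X_3\<close> span the algebra and are pointed in the same way, and the
  transition to \<open>B\<close> is triangular.

  For linear independence and positivity, the coefficient of an element of \<open>B\<close> in a linear combination is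
  read off from the Laurent expansion of the combination in a suitable cluster, at an exponent vector where
  the expansion of this element has coefficient \<open>1\<close> and those of the other elements vanish. For a cluster
  monomial these are its own cluster and exponents: any other element of \<open>B\<close> has no term there, because a
  degree with positive weights, computed by the tropical exchange relations, is negative on it. For
  \<open>F_n(X_delta)\<close> it is the exponent \<open>(-n, 2n)\<close> in a cluster far to the right of all cluster monomials that
  occur. The expansions in the other clusters are reduced to the initial one by the substitutions
  \<open>X_k \<mapsto> X_(c + s k)\<close>, \<open>t \<mapsto> t^s\<close> with \<open>c\<close> even and \<open>s = 1\<close> or \<open>s = -1\<close>.
\<close>

section \<open>The quantum torus\<close>

lemma poly_mapping_plus_induct [case_names single plus]:
  fixes f :: "'a \<Rightarrow>\<^sub>0 'b::comm_monoid_add"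
  assumes single: "\<And>a b. P (Poly_Mapping.single a b)"
    and plus: "\<And>f g. P f \<Longrightarrow> P g \<Longrightarrow> P (f + g)"
  shows "P f"
proof (induction f rule: update_induct)
  case const
  show ?case using single[of undefined 0] by simp
next
  case (update f a b)
  have "Poly_Mapping.update a b f = f + Poly_Mapping.single a b"
    using update(1)
    by (intro poly_mapping_eqI)
       (auto simp: lookup_update lookup_add lookup_single in_keys_iff when_def)
  then show ?case using plus single update by simp
qed

lemma tq_add: "tq (i + j) = tq i * tq j"
  by (simp add: tq_def mult_single)

lemma tq_0 [simp]: "tq 0 = 1"
  by (simp add: tq_def)

lemma tq_nonzero [simp]: "tq i \<noteq> 0"
  by (simp add: tq_def)

lemma lam_add_left: "lam (e + e') f = lam e f + lam e' f"
  and lam_add_right: "lam f (e + e') = lam f e + lam f e'"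
  by (simp_all add: lam_def algebra_simps)

lemma lam_zero [simp]: "lam 0 e = 0" "lam e 0 = 0"
  and lam_self [simp]: "lam e e = 0"
  by (simp_all add: lam_def)

lemma tmult_eq_sum_single:
  "x \<star> y = (\<Sum>e\<in>Poly_Mapping.keys x. \<Sum>f\<in>Poly_Mapping.keys y.
     Poly_Mapping.single (e + f) (Poly_Mapping.lookup x e * Poly_Mapping.lookup y f * tq (lam e f)))"
  by (simp add: tmult_def plus_prod_def)

lemma tmult_single:
  "Poly_Mapping.single e a \<star> Poly_Mapping.single f b = Poly_Mapping.single (e + f) (a * b * tq (lam e f))"
  by (cases "a = 0"; cases "b = 0") (simp_all add: tmult_eq_sum_single)

lemma tmult_add_left: "(x + y) \<star> z = x \<star> z + y \<star> z"
  unfolding tmult_eq_sum_single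
  by (subst setsum_keys_plus_distrib[where f = "\<lambda>e c. \<Sum>f\<in>Poly_Mapping.keys z.
     Poly_Mapping.single (e + f) (c * Poly_Mapping.lookup z f * tq (lam e f))"])
     (simp_all add: sum.distrib algebra_simps single_add)

lemma tmult_add_right: "z \<star> (x + y) = z \<star> x + z \<star> y"
  unfolding tmult_eq_sum_single sum.distrib[symmetric]
  by (intro sum.cong refl,
      subst setsum_keys_plus_distrib[where f = "\<lambda>f c.
        Poly_Mapping.single (_ + f) (Poly_Mapping.lookup z _ * c * tq (lam _ f))"])
     (simp_all add: algebra_simps single_add)

lemma tmult_assoc: "(x \<star> y) \<star> z = x \<star> (y \<star> z)"
proof (induction x rule: poly_mapping_plus_induct)
  case (single a b)
  then show ?case
  proof (induction y rule: poly_mapping_plus_induct)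
    case (single c d)
    then show ?case
      by (induction z rule: poly_mapping_plus_induct)
         (simp_all add: tmult_single tmult_add_right lam_add_left lam_add_right tq_add ac_simps)
  qed (simp add: tmult_add_left tmult_add_right)
qed (simp add: tmult_add_left)

lemma tone_tmult: "tone \<star> x = x"
  and tmult_tone: "x \<star> tone = x"
  by (induction x rule: poly_mapping_plus_induct;
      simp add: tone_def qmon_def tmult_single tmult_add_left tmult_add_right plus_prod_def lam_def)+

lemma tsmul_single: "tsmul c (Poly_Mapping.single e a) = Poly_Mapping.single e (c * a)"
  by (simp add: tsmul_def tmult_single flip: zero_prod_def)

lemma tsmul_add_right: "tsmul c (x + y) = tsmul c x + tsmul c y"
  by (simp add: tsmul_def tmult_add_right)

lemma lookup_tsmul: "Poly_Mapping.lookup (tsmul c x) e = c * Poly_Mapping.lookup x e"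
  by (induction x rule: poly_mapping_plus_induct)
     (simp_all add: tsmul_single tsmul_add_right lookup_single lookup_add when_def distrib_left)

lemma tmult_tsmul: "x \<star> tsmul c y = tsmul c (x \<star> y)"
proof (induction x rule: poly_mapping_plus_induct)
  case (single e a)
  show ?case
    by (induction y rule: poly_mapping_plus_induct)
       (simp_all add: tsmul_single tmult_single tsmul_add_right tmult_add_right ac_simps)
qed (simp add: tmult_add_left tsmul_add_right)

text \<open>The product \<open>\<star>\<close> differs from the convolution product of type \<open>qtorus\<close>, hence a copy of
  the type for the ring structure.\<close>

typedef torus = "UNIV :: qtorus set" morphisms qtorus_of torus_of
  by simp

lifting_forget poly_mapping.lifting

setup_lifting type_definition_torus

instantiation torus :: ring_1
begin
lift_definition zero_torus :: torus is 0 .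
lift_definition one_torus :: torus is tone .
lift_definition plus_torus :: "torus \<Rightarrow> torus \<Rightarrow> torus" is plus .
lift_definition minus_torus :: "torus \<Rightarrow> torus \<Rightarrow> torus" is minus .
lift_definition uminus_torus :: "torus \<Rightarrow> torus" is uminus .
lift_definition times_torus :: "torus \<Rightarrow> torus \<Rightarrow> torus" is tmult .
instance
proof
  fix a b c :: torus
  show "a * b * c = a * (b * c)" by transfer (rule tmult_assoc)
  show "(a + b) * c = a * c + b * c" by transfer (rule tmult_add_left)
  show "a * (b + c) = a * b + a * c" by transfer (rule tmult_add_right)
  show "1 * a = a" by transfer (rule tone_tmult)
  show "a * 1 = a" by transfer (rule tmult_tone)
  show "(0::torus) \<noteq> 1"
    by transfer (metis lookup_single_eq lookup_zero qmon_def tone_def zero_neq_one)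
qed (transfer, simp add: algebra_simps)+
end

lift_definition coeff :: "torus \<Rightarrow> int \<times> int \<Rightarrow> lpoly" is Poly_Mapping.lookup .
lift_definition supp :: "torus \<Rightarrow> (int \<times> int) set" is Poly_Mapping.keys .
lift_definition Xmon :: "int \<times> int \<Rightarrow> torus" is qmon .
lift_definition scale :: "lpoly \<Rightarrow> torus \<Rightarrow> torus" (infixr \<open>\<cdot>\<close> 75) is tsmul .

lemma torus_eqI: "(\<And>e. coeff x e = coeff y e) \<Longrightarrow> x = y"
  by transfer (rule poly_mapping_eqI)

lemma in_supp_iff: "e \<in> supp x \<longleftrightarrow> coeff x e \<noteq> 0"
  by transfer (rule in_keys_iff)

lemma finite_supp [simp]: "finite (supp x)"
  by transfer simp

lemma supp_eq_empty_iff: "supp x = {} \<longleftrightarrow> x = 0"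
  by transfer simp

lemma supp_zero [simp]: "supp 0 = {}"
  by (simp add: supp_eq_empty_iff)

lemma coeff_zero [simp]: "coeff 0 e = 0"
  and coeff_add [simp]: "coeff (x + y) e = coeff x e + coeff y e"
  and coeff_diff [simp]: "coeff (x - y) e = coeff x e - coeff y e"
  and coeff_uminus [simp]: "coeff (- x) e = - coeff x e"
  and coeff_scale [simp]: "coeff (c \<cdot> x) e = c * coeff x e"
  by (transfer; simp add: lookup_add lookup_minus lookup_tsmul)+

lemma coeff_sum [simp]: "coeff (sum f A) e = (\<Sum>a\<in>A. coeff (f a) e)"
  by (induction A rule: infinite_finite_induct) auto

lemma coeff_Xmon: "coeff (Xmon e) f = (if e = f then 1 else 0)"
  by transfer (simp add: qmon_def lookup_single when_def)

lemma Xmon_zero: "Xmon 0 = 1"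
  by transfer (simp add: tone_def zero_prod_def)

lemma coeff_one: "coeff 1 e = (if e = 0 then 1 else 0)"
  by (simp add: coeff_Xmon flip: Xmon_zero)

lemma supp_Xmon [simp]: "supp (Xmon e) = {e}"
  by (auto simp: in_supp_iff coeff_Xmon split: if_splits)

lemma Xmon_nonzero [simp]: "Xmon e \<noteq> 0"
  using supp_eq_empty_iff[of "Xmon e"] by simp

lemma supp_add: "supp (x + y) \<subseteq> supp x \<union> supp y"
  and supp_diff: "supp (x - y) \<subseteq> supp x \<union> supp y"
  and supp_scale: "supp (c \<cdot> x) \<subseteq> supp x"
  by (auto simp: in_supp_iff)

lemma supp_scale_tq [simp]: "supp (tq i \<cdot> x) = supp x"
  by (auto simp: in_supp_iff)

lemma scale_add_left: "(c + d) \<cdot> x = c \<cdot> x + d \<cdot> x"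
  and scale_diff_left: "(c - d) \<cdot> x = c \<cdot> x - d \<cdot> x"
  and scale_minus_left: "(- c) \<cdot> x = - (c \<cdot> x)"
  and scale_add_right: "c \<cdot> (x + y) = c \<cdot> x + c \<cdot> y"
  and scale_diff_right: "c \<cdot> (x - y) = c \<cdot> x - c \<cdot> y"
  and scale_zero_left [simp]: "0 \<cdot> x = 0"
  and scale_zero_right [simp]: "c \<cdot> 0 = 0"
  and scale_one [simp]: "1 \<cdot> x = x"
  and scale_scale [simp]: "c \<cdot> d \<cdot> x = (c * d) \<cdot> x"
  by (intro torus_eqI; simp add: algebra_simps)+

lemma scale_mult_left [simp]: "(c \<cdot> x) * y = c \<cdot> (x * y)"
  by transfer (simp add: tsmul_def tmult_assoc)

lemma scale_mult_right [simp]: "x * (c \<cdot> y) = c \<cdot> (x * y)"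
  by transfer (rule tmult_tsmul)

lemma scale_sum_right: "c \<cdot> sum f A = (\<Sum>a\<in>A. c \<cdot> f a)"
  by (intro torus_eqI) (simp add: sum_distrib_left)

lemmas scale_algebra_simps = scale_add_left scale_diff_left scale_minus_left
  scale_add_right scale_diff_right tq_add[symmetric] algebra_simps

interpretation torus: module scale
  by unfold_locales (simp_all add: scale_add_left scale_add_right)

lemma Xmon_mult: "Xmon e * Xmon f = tq (lam e f) \<cdot> Xmon (e + f)"
  by transfer (simp add: qmon_def tmult_single tsmul_single)

lemma eq_sum_Xmon: "x = (\<Sum>e\<in>supp x. coeff x e \<cdot> Xmon e)"
  by (intro torus_eqI) (auto simp: coeff_Xmon in_supp_iff sum.delta if_distrib cong: if_cong)

lemma coeff_mult:
  "coeff (x * y) g = (\<Sum>e\<in>supp x. \<Sum>f\<in>supp y. if e + f = g then coeff x e * coeff y f * tq (lam e f) else 0)"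
  by transfer (simp add: tmult_eq_sum_single lookup_sum lookup_single when_def)

lemma supp_multE:
  assumes "g \<in> supp (x * y)"
  obtains e f where "e \<in> supp x" "f \<in> supp y" "g = e + f"
proof -
  have "\<exists>e\<in>supp x. \<exists>f\<in>supp y. g = e + f"
  proof (rule ccontr)
    assume "\<not> ?thesis"
    then have "coeff (x * y) g = 0"
      unfolding coeff_mult by (intro sum.neutral ballI) auto
    with assms show False by (simp add: in_supp_iff)
  qed
  with that show ?thesis by blast
qed

lemma coeff_mult_unique:
  assumes "\<And>e' f'. e' \<in> supp x \<Longrightarrow> f' \<in> supp y \<Longrightarrow> e' + f' = e + f \<Longrightarrow> e' = e"
  shows "coeff (x * y) (e + f) = coeff x e * coeff y f * tq (lam e f)"
proof -
  have "coeff (x * y) (e + f) = (\<Sum>e'\<in>supp x. \<Sum>f'\<in>supp y.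
      if e' = e \<and> f' = f then coeff x e * coeff y f * tq (lam e f) else 0)"
  proof (unfold coeff_mult, intro sum.cong refl if_cong)
    fix e' f' assume "e' \<in> supp x" "f' \<in> supp y"
    then show "e' + f' = e + f \<longleftrightarrow> e' = e \<and> f' = f"
      using assms by (metis add_left_cancel)
  qed auto
  also have "\<dots> = (\<Sum>e'\<in>supp x. if e' = e then coeff x e * coeff y f * tq (lam e f) else 0)"
    by (intro sum.cong refl) (auto simp: in_supp_iff sum.delta')
  also have "\<dots> = coeff x e * coeff y f * tq (lam e f)"
    by (auto simp: in_supp_iff)
  finally show ?thesis .
qed

definition wt :: "int \<times> int \<Rightarrow> int \<times> int \<Rightarrow> int" where
  "wt g e = fst g * fst e + snd g * snd e"

lemma wt_add: "wt g (e + f) = wt g e + wt g f"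
  and wt_zero [simp]: "wt g 0 = 0"
  by (simp_all add: wt_def algebra_simps)

definition leading_exp :: "int \<times> int \<Rightarrow> torus \<Rightarrow> int \<times> int \<Rightarrow> bool" where
  "leading_exp g x e \<longleftrightarrow> e \<in> supp x \<and> (\<forall>e'\<in>supp x. (wt g e', e') \<le> (wt g e, e))"

lemma leading_exp_exists:
  assumes "x \<noteq> 0"
  obtains e where "leading_exp g x e"
proof -
  let ?S = "(\<lambda>e. (wt g e, e)) ` supp x"
  have "?S \<noteq> {}" using assms by (simp add: supp_eq_empty_iff)
  then have "Max ?S \<in> ?S" by (intro Max_in) auto
  then obtain e where e_max: "e \<in> supp x" "Max ?S = (wt g e, e)" by auto
  have "(wt g e', e') \<le> (wt g e, e)" if "e' \<in> supp x" for e'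
    using that unfolding e_max(2)[symmetric] by (intro Max_ge) auto
  with e_max(1) have "leading_exp g x e" unfolding leading_exp_def by blast
  then show ?thesis by (rule that)
qed

lemma leading_exp_mult_in_supp:
  assumes "leading_exp g x e" "leading_exp g y f"
  shows "e + f \<in> supp (x * y)"
proof -
  have "coeff (x * y) (e + f) = coeff x e * coeff y f * tq (lam e f)"
  proof (rule coeff_mult_unique)
    fix e' f' assume supp: "e' \<in> supp x" "f' \<in> supp y" and eq: "e' + f' = e + f"
    then have "wt g e' + wt g f' = wt g e + wt g f"
      by (simp flip: wt_add)
    moreover have "(wt g e', e') \<le> (wt g e, e)" "(wt g f', f') \<le> (wt g f, f)"
      using assms supp by (simp_all add: leading_exp_def)
    ultimately show "e' = e"
      using eq by (cases e; cases e'; cases f; cases f') (auto simp: less_eq_prod_def less_prod_def)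
  qed
  then show ?thesis using assms by (simp add: leading_exp_def in_supp_iff)
qed

instance torus :: ring_1_no_zero_divisors
proof
  fix x y :: torus assume "x \<noteq> 0" "y \<noteq> 0"
  then show "x * y \<noteq> 0"
    by (metis empty_iff leading_exp_exists leading_exp_mult_in_supp supp_eq_empty_iff)
qed

lemma scale_eq_0_iff [simp]: "c \<cdot> x = 0 \<longleftrightarrow> c = 0 \<or> x = 0"
proof -
  have "c \<cdot> (1::torus) = 0 \<longleftrightarrow> c = 0"
    by (metis coeff_one coeff_scale coeff_zero mult.right_neutral scale_zero_left)
  moreover have "c \<cdot> x = c \<cdot> 1 * x" by simp
  ultimately show ?thesis by (metis mult_eq_0_iff)
qed

lemma qcommute_power_right:
  assumes "x * y = tq i \<cdot> (y * x)"
  shows "x * y ^ b = tq (i * int b) \<cdot> (y ^ b * x)"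
proof (induction b)
  case (Suc b)
  have "x * y ^ Suc b = (x * y) * y ^ b" by (simp add: mult.assoc)
  also have "\<dots> = tq i \<cdot> (y * (x * y ^ b))" by (simp add: assms mult.assoc)
  also have "\<dots> = tq (i * int (Suc b)) \<cdot> (y ^ Suc b * x)"
    by (simp add: Suc mult.assoc algebra_simps flip: tq_add)
  finally show ?case .
qed simp

lemma qcommute_power:
  assumes "x * y = tq i \<cdot> (y * x)"
  shows "x ^ a * y ^ b = tq (i * int a * int b) \<cdot> (y ^ b * x ^ a)"
proof (induction a)
  case (Suc a)
  have "x ^ Suc a * y ^ b = x * (x ^ a * y ^ b)" by (simp add: mult.assoc)
  also have "\<dots> = tq (i * int a * int b) \<cdot> ((x * y ^ b) * x ^ a)" by (simp add: Suc mult.assoc)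
  also have "\<dots> = tq (i * int (Suc a) * int b) \<cdot> (y ^ b * x ^ Suc a)"
    by (simp add: qcommute_power_right[OF assms] mult.assoc algebra_simps flip: tq_add)
  finally show ?case .
qed simp

section \<open>The cluster variables\<close>

lemma int_bidirectional_induct [case_names base base_Suc step]:
  fixes j k :: int
  assumes "P k" "P (k + 1)"
    and step: "\<And>j s. \<bar>s\<bar> = 1 \<Longrightarrow> P (j - s) \<Longrightarrow> P j \<Longrightarrow> P (j + s)"
  shows "P j"
proof -
  have "P j \<and> P (j + 1)"
  proof (induction j rule: int_induct[where k = k])
    case (step1 i)
    then show ?case using step[of 1 "i + 1"] by simp
  next
    case (step2 i)
    then show ?case using step[of "-1" i] by simp
  qed (use assms in simp)
  then show ?thesis ..
qed

lift_definition X_delta :: torus is Xdelta .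

lemma X_delta_eq:
  "X_delta = Xmon (-1, -2) + Xmon (-1, 2) + Xmon (1, -2) + (tq (-1) + tq 1) \<cdot> Xmon (0, -2)"
  by transfer (simp add: Xdelta_def)

text \<open>\<open>Xeven j\<close> is \<open>X_(2 j)\<close>; the linear recurrence, unlike the exchange relations, involves no division.\<close>

function Xeven :: "int \<Rightarrow> torus" where
  "Xeven j =
    (if j = 0 then Xmon (1, -1) + Xmon (0, -1)
     else if j = 1 then Xmon (0, 1)
     else if j > 1 then tq 1 \<cdot> (X_delta * Xeven (j - 1)) - tq 2 \<cdot> Xeven (j - 2)
     else tq (-1) \<cdot> (X_delta * Xeven (j + 1)) - tq (-2) \<cdot> Xeven (j + 2))"
  by auto
termination by (relation "measure (\<lambda>j. nat \<bar>2 * j - 1\<bar>)") auto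

declare Xeven.simps [simp del]

definition Xvar :: "int \<Rightarrow> torus" where
  "Xvar k = (if even k then Xeven (k div 2)
     else tq (-1) \<cdot> (Xeven (k div 2) * Xeven (k div 2 + 1) - 1))"

lemma Xvar_even: "Xvar (2 * j) = Xeven j"
  by (simp add: Xvar_def)

lemma Xvar_odd: "Xvar (2 * j + 1) = tq (-1) \<cdot> (Xeven j * Xeven (j + 1) - 1)"
  by (simp add: Xvar_def)

lemma Xeven_recurrence:
  assumes "\<bar>s\<bar> = 1"
  shows "Xeven (j + s) = tq s \<cdot> (X_delta * Xeven j) - tq (2 * s) \<cdot> Xeven (j - s)"
proof -
  have up: "Xeven (j + 1) = tq 1 \<cdot> (X_delta * Xeven j) - tq 2 \<cdot> Xeven (j - 1)" for j
  proof (cases "j \<ge> 1")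
    case True
    then show ?thesis by (subst Xeven.simps) auto
  next
    case False
    then have down: "Xeven (j - 1) = tq (-1) \<cdot> (X_delta * Xeven j) - tq (-2) \<cdot> Xeven (j + 1)"
      by (subst Xeven.simps) (auto simp: add.commute)
    show ?thesis unfolding down by (simp add: scale_algebra_simps)
  qed
  moreover have "Xeven (j - 1) = tq (-1) \<cdot> (X_delta * Xeven j) - tq (-2) \<cdot> Xeven (j + 1)"
    unfolding up[of j] by (simp add: scale_algebra_simps)
  moreover from assms have "s = 1 \<or> s = -1" by linarith
  ultimately show ?thesis by auto
qed

lemma X_delta_Xeven:
  "\<bar>s\<bar> = 1 \<Longrightarrow> X_delta * Xeven j = tq (- s) \<cdot> Xeven (j + s) + tq s \<cdot> Xeven (j - s)"
  by (simp add: Xeven_recurrence scale_algebra_simps)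

lemma Xeven_0: "Xeven 0 = Xmon (1, -1) + Xmon (0, -1)"
  and Xeven_1: "Xeven 1 = Xmon (0, 1)"
  by (simp_all add: Xeven.simps)

lemma Xeven_2: "Xeven 2 = Xmon (-1, 3) + Xmon (-1, -1) + Xmon (0, -1)"
  using Xeven_recurrence[of 1 1]
  by (simp add: Xeven_0 Xeven_1 X_delta_eq scale_algebra_simps Xmon_mult lam_def)

lemma Xeven_X_delta:
  assumes "\<bar>s\<bar> = 1"
  shows "Xeven j * X_delta = tq s \<cdot> Xeven (j + s) + tq (- s) \<cdot> Xeven (j - s)"
proof -
  have "Xeven j * X_delta = tq 1 \<cdot> Xeven (j + 1) + tq (-1) \<cdot> Xeven (j - 1)"
  proof (induction j rule: int_bidirectional_induct[where k = 0])
    case base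
    show ?case using Xeven_recurrence[of "-1" 0]
      by (simp add: Xeven_0 Xeven_1 X_delta_eq scale_algebra_simps Xmon_mult lam_def)
  next
    case base_Suc
    show ?case
      by (simp add: Xeven_0 Xeven_1 Xeven_2 X_delta_eq scale_algebra_simps Xmon_mult lam_def)
  next
    case (step j s)
    have right: "Xeven i * X_delta = tq s \<cdot> Xeven (i + s) + tq (- s) \<cdot> Xeven (i - s)"
      if "Xeven i * X_delta = tq 1 \<cdot> Xeven (i + 1) + tq (-1) \<cdot> Xeven (i - 1)" for i
      using that step(1) by (cases "s = 1") (auto simp: abs_if split: if_splits)
    have "Xeven (j + s) * X_delta =
        tq s \<cdot> (X_delta * (Xeven j * X_delta)) - tq (2 * s) \<cdot> (Xeven (j - s) * X_delta)"
      by (simp add: Xeven_recurrence[OF step(1)] left_diff_distrib mult.assoc)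
    also have "\<dots> = tq (2 * s) \<cdot> (X_delta * Xeven (j + s)) + X_delta * Xeven (j - s)
        - tq (3 * s) \<cdot> Xeven j - tq s \<cdot> Xeven (j - s - s)"
      using right[OF step(2)] right[OF step(3)] by (simp add: scale_algebra_simps)
    also have "\<dots> = tq s \<cdot> Xeven (j + s + s) + tq (- s) \<cdot> Xeven j"
      by (simp add: X_delta_Xeven[OF step(1)] scale_algebra_simps)
    finally show ?case
      using step(1) by (cases "s = 1") (auto simp: abs_if algebra_simps split: if_splits)
  qed
  moreover from assms have "s = 1 \<or> s = -1" by linarith
  ultimately show ?thesis by (auto simp: algebra_simps)
qed

lemma int_const_of_shift_invariant:
  fixes f :: "int \<Rightarrow> 'a"
  assumes "\<bar>s\<bar> = 1" and shift: "\<And>j. f (j + s) = f j"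
  shows "f j = f k"
proof (induction j rule: int_induct[where k = k])
  case (step1 i)
  from assms(1) have "s = 1 \<or> s = -1" by linarith
  then show ?case using step1 shift[of i] shift[of "i + 1"] by auto
next
  case (step2 i)
  from assms(1) have "s = 1 \<or> s = -1" by linarith
  then show ?case using step2 shift[of i] shift[of "i - 1"] by auto
qed simp

lemma X_delta_eq_Xeven:
  assumes "\<bar>s\<bar> = 1"
  shows "X_delta = tq s \<cdot> (Xeven (j - s) * Xeven (j + s)) - tq (3 * s) \<cdot> (Xeven j * Xeven j)"
proof -
  define conserved where "conserved j = tq s \<cdot> (Xeven (j - s) * Xeven (j + s)) - tq (3 * s) \<cdot> (Xeven j * Xeven j)" for j
  have "conserved (j + s) = conserved j" for j
  proof -
    have "conserved (j + s) = tq s \<cdot> (Xeven j * Xeven (j + s + s)) - tq (3 * s) \<cdot> (Xeven (j + s) * Xeven (j + s))"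
      by (simp add: conserved_def)
    also have "\<dots> = tq (2 * s) \<cdot> ((Xeven j * X_delta) * Xeven (j + s)) - tq (3 * s) \<cdot> (Xeven j * Xeven j)
        - tq (3 * s) \<cdot> (Xeven (j + s) * Xeven (j + s))"
      unfolding Xeven_recurrence[OF assms, of "j + s"] by (simp add: scale_algebra_simps)
    also have "\<dots> = conserved j"
      unfolding Xeven_X_delta[OF assms, of j] by (simp add: conserved_def scale_algebra_simps)
    finally show ?thesis .
  qed
  then have "conserved j = conserved 1" by (rule int_const_of_shift_invariant[OF assms])
  also have "conserved 1 = X_delta"
    using assms by (cases "s = 1")
      (auto simp: abs_if conserved_def Xeven_0 Xeven_1 Xeven_2 X_delta_eq scale_algebra_simps Xmon_mult lam_def
        split: if_splits)
  finally show ?thesis by (simp add: conserved_def)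
qed

lemma Xeven_mult_Xeven:
  assumes "\<bar>s\<bar> = 1"
  shows "Xeven j * Xeven (j + s) = tq (2 * s) \<cdot> (Xeven (j + s) * Xeven j) + (1 - tq (2 * s)) \<cdot> 1"
proof -
  define conserved where "conserved j = Xeven j * Xeven (j + s) - tq (2 * s) \<cdot> (Xeven (j + s) * Xeven j)" for j
  have "conserved (j + s) = conserved j" for j
  proof -
    have left: "Xeven (j + s + s) = tq (- s) \<cdot> (Xeven (j + s) * X_delta) - tq (- 2 * s) \<cdot> Xeven j"
      by (simp add: Xeven_X_delta[OF assms] scale_algebra_simps)
    have "conserved (j + s) = Xeven (j + s) * Xeven (j + s + s) - tq (2 * s) \<cdot> (Xeven (j + s + s) * Xeven (j + s))"
      by (simp add: conserved_def)
    also have "Xeven (j + s) * Xeven (j + s + s) =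
        tq s \<cdot> (Xeven (j + s) * (X_delta * Xeven (j + s))) - tq (2 * s) \<cdot> (Xeven (j + s) * Xeven j)"
      unfolding Xeven_recurrence[OF assms, of "j + s"] by (simp add: scale_algebra_simps)
    also have "Xeven (j + s + s) * Xeven (j + s) =
        tq (- s) \<cdot> (Xeven (j + s) * (X_delta * Xeven (j + s))) - tq (- 2 * s) \<cdot> (Xeven j * Xeven (j + s))"
      unfolding left by (simp add: scale_algebra_simps)
    finally show ?thesis by (simp add: conserved_def scale_algebra_simps)
  qed
  then have "conserved j = conserved (if s = 1 then 0 else 1)" by (rule int_const_of_shift_invariant[OF assms])
  also have "\<dots> = (1 - tq (2 * s)) \<cdot> 1"
    using assms by (cases "s = 1")
      (auto simp: abs_if conserved_def Xeven_0 Xeven_1 scale_algebra_simps Xmon_mult lam_def zero_prod_def[symmetric]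
        Xmon_zero split: if_splits)
  finally show ?thesis by (simp add: conserved_def algebra_simps)
qed

lemma Xeven_mult_Xeven_eq_Xvar:
  assumes "\<bar>s\<bar> = 1"
  shows "Xeven j * Xeven (j + s) = tq s \<cdot> Xvar (2 * j + s) + 1"
proof (cases "s = 1")
  case True
  then show ?thesis unfolding True Xvar_odd by (simp add: scale_algebra_simps)
next
  case False
  with assms have s_eq: "s = -1" by linarith
  have "2 * j + s = 2 * (j - 1) + 1" using s_eq by simp
  then have "Xvar (2 * j + s) = tq (-1) \<cdot> (Xeven (j - 1) * Xeven j - 1)"
    by (simp only: Xvar_odd) simp
  also have "Xeven (j - 1) * Xeven j = tq 2 \<cdot> (Xeven j * Xeven (j - 1)) + (1 - tq 2) \<cdot> 1"
    using Xeven_mult_Xeven[of 1 "j - 1"] by simp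
  finally have odd: "Xvar (2 * j + s) =
      tq (-1) \<cdot> (tq 2 \<cdot> (Xeven j * Xeven (j - 1)) + (1 - tq 2) \<cdot> 1 - 1)" .
  show ?thesis unfolding odd unfolding s_eq by (simp add: scale_algebra_simps)
qed

lemma Xvar_adjacent_odd:
  "\<bar>s\<bar> = 1 \<Longrightarrow> Xvar (2 * j + s) = tq (- s) \<cdot> (Xeven j * Xeven (j + s) - 1)"
  by (simp add: Xeven_mult_Xeven_eq_Xvar scale_algebra_simps)

lemma Xeven_qcommute_Xvar:
  assumes "\<bar>s\<bar> = 1"
  shows "Xeven j * Xvar (2 * j + s) = tq (2 * s) \<cdot> (Xvar (2 * j + s) * Xeven j)"
proof -
  have swap: "Xeven (j + s) * Xeven j = tq (- 2 * s) \<cdot> (Xeven j * Xeven (j + s)) + (1 - tq (- 2 * s)) \<cdot> 1"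
    unfolding Xeven_mult_Xeven[OF assms, of j] by (simp add: scale_algebra_simps)
  show ?thesis
    unfolding Xvar_adjacent_odd[OF assms] by (simp add: swap scale_algebra_simps)
qed

theorem Xvar_qcommute:
  assumes "\<bar>s\<bar> = 1"
  shows "Xvar k * Xvar (k + s) = tq (2 * s) \<cdot> (Xvar (k + s) * Xvar k)"
proof (cases "even k")
  case True
  then obtain j where "k = 2 * j" by (elim evenE)
  then show ?thesis using Xeven_qcommute_Xvar[OF assms, of j] by (simp add: Xvar_even)
next
  case False
  from assms have "s = 1 \<or> s = -1" by linarith
  with False have "even (k + s)" by auto
  then obtain j where "k + s = 2 * j" by (elim evenE)
  then have k_eq: "k = 2 * j + - s" by simp
  have "Xeven j * Xvar k = tq (- 2 * s) \<cdot> (Xvar k * Xeven j)"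
    using Xeven_qcommute_Xvar[of "- s" j] assms unfolding k_eq by simp
  then show ?thesis
    unfolding \<open>k + s = 2 * j\<close> Xvar_even by (simp flip: tq_add)
qed

definition exch_exp :: "int \<Rightarrow> nat" where
  "exch_exp k = (if even k then 4 else 1)"

theorem Xvar_exchange:
  assumes "\<bar>s\<bar> = 1"
  shows "Xvar (k - s) * Xvar (k + s) = tq (s * int (exch_exp k)) \<cdot> Xvar k ^ exch_exp k + 1"
proof (cases "even k")
  case True
  then obtain j where k_eq: "k = 2 * j" by (elim evenE)
  define a b c where abc_eq: "a = Xeven (j - s)" "b = Xeven j" "c = Xeven (j + s)"
  have a_mult_b: "a * b = tq (2 * s) \<cdot> (b * a) + (1 - tq (2 * s)) \<cdot> 1"
    using Xeven_mult_Xeven[OF assms, of "j - s"] by (simp add: abc_eq)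
  have a_mult_c: "a * c = tq (- s) \<cdot> X_delta + tq (2 * s) \<cdot> (b * b)"
    by (subst X_delta_eq_Xeven[OF assms, of j]) (simp add: abc_eq scale_algebra_simps)
  have b_mult_X_delta: "b * X_delta = tq s \<cdot> c + tq (- s) \<cdot> a"
    by (simp add: abc_eq Xeven_X_delta[OF assms])
  have left: "Xvar (k - s) = tq s \<cdot> (b * a - 1)" and right: "Xvar (k + s) = tq (- s) \<cdot> (b * c - 1)"
    using Xvar_adjacent_odd[of "- s" j] Xvar_adjacent_odd[of s j] assms by (simp_all add: k_eq abc_eq)
  have "(b * a - 1) * (b * c - 1) = b * (a * b) * c - b * a - b * c + 1"
    by (simp add: algebra_simps)
  also have "\<dots> = tq (2 * s) \<cdot> (b * b * (a * c)) - tq (2 * s) \<cdot> (b * c) - b * a + 1"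
    unfolding a_mult_b by (simp add: scale_algebra_simps)
  also have "\<dots> = tq s \<cdot> (b * (b * X_delta)) + tq (4 * s) \<cdot> b ^ 4 - tq (2 * s) \<cdot> (b * c) - b * a + 1"
    unfolding a_mult_c by (simp add: scale_algebra_simps power4_eq_xxxx)
  also have "\<dots> = tq (4 * s) \<cdot> b ^ 4 + 1"
    unfolding b_mult_X_delta by (simp add: scale_algebra_simps)
  finally show ?thesis
    using True unfolding left right unfolding k_eq Xvar_even abc_eq(2)[symmetric]
    by (simp add: exch_exp_def mult.commute flip: tq_add)
next
  case False
  from assms have "s = 1 \<or> s = -1" by linarith
  with False have "even (k - s)" by auto
  then obtain j where "k - s = 2 * j" by (elim evenE)
  then have "2 * j + s = k" "k + s = 2 * (j + s)" by simp_all
  then show ?thesis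
    using Xeven_mult_Xeven_eq_Xvar[OF assms, of j] False
    unfolding \<open>k - s = 2 * j\<close> \<open>k + s = 2 * (j + s)\<close> Xvar_even by (simp add: exch_exp_def)
qed

lemma Xvar_0: "Xvar 0 = Xmon (1, -1) + Xmon (0, -1)"
  and Xvar_1: "Xvar 1 = Xmon (1, 0)"
  and Xvar_2: "Xvar 2 = Xmon (0, 1)"
  and Xvar_3: "Xvar 3 = Xmon (-1, 4) + Xmon (-1, 0)"
  by (simp_all add: Xvar_def Xeven_0 Xeven_1 Xeven_2 scale_algebra_simps Xmon_mult lam_def
      zero_prod_def[symmetric] Xmon_zero)

section \<open>Pointed elements\<close>

definition pt_le :: "int \<times> int \<Rightarrow> int \<times> int \<Rightarrow> bool" (infix \<open>\<preceq>\<close> 50) where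
  "p \<preceq> r \<longleftrightarrow> fst p \<le> fst r \<and> snd p \<le> snd r"

lemma pt_le_refl [simp]: "p \<preceq> p"
  by (simp add: pt_le_def)

lemma pt_le_trans: "p \<preceq> q \<Longrightarrow> q \<preceq> r \<Longrightarrow> p \<preceq> r"
  by (simp add: pt_le_def)

lemma pt_le_antisym: "p \<preceq> r \<Longrightarrow> r \<preceq> p \<Longrightarrow> p = r"
  by (simp add: pt_le_def prod_eq_iff)

lemma pt_le_add_mono: "p \<preceq> p' \<Longrightarrow> r \<preceq> r' \<Longrightarrow> p + r \<preceq> p' + r'"
  by (simp add: pt_le_def)

definition supp_above :: "int \<times> int \<Rightarrow> torus \<Rightarrow> bool" where
  "supp_above p x \<longleftrightarrow> (\<forall>e\<in>supp x. p \<preceq> e)"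

lemma supp_above_mono: "supp_above r x \<Longrightarrow> p \<preceq> r \<Longrightarrow> supp_above p x"
  unfolding supp_above_def by (metis pt_le_trans)

lemma supp_above_add: "supp_above p x \<Longrightarrow> supp_above p y \<Longrightarrow> supp_above p (x + y)"
  and supp_above_scale: "supp_above p x \<Longrightarrow> supp_above p (c \<cdot> x)"
  using supp_add supp_scale by (fastforce simp: supp_above_def)+

lemma supp_above_mult: "supp_above p x \<Longrightarrow> supp_above r y \<Longrightarrow> supp_above (p + r) (x * y)"
  unfolding supp_above_def by (metis supp_multE pt_le_add_mono)

lemma supp_above_Xmon [simp]: "supp_above p (Xmon e) \<longleftrightarrow> p \<preceq> e"
  by (simp add: supp_above_def)

definition pointed :: "int \<times> int \<Rightarrow> torus \<Rightarrow> bool" where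
  "pointed p x \<longleftrightarrow> supp_above p x \<and> (\<exists>i. coeff x p = tq i)"

lemma pointed_supp_above: "pointed p x \<Longrightarrow> supp_above p x"
  by (simp add: pointed_def)

lemma pointed_in_supp: "pointed p x \<Longrightarrow> p \<in> supp x"
  by (auto simp: pointed_def in_supp_iff)

lemma pointed_nonzero: "pointed p x \<Longrightarrow> x \<noteq> 0"
  using pointed_in_supp supp_eq_empty_iff by blast

lemma pointed_unique: "pointed p x \<Longrightarrow> pointed r x \<Longrightarrow> p = r"
  by (meson pointed_in_supp pointed_supp_above pt_le_antisym supp_above_def)

lemma pointed_Xmon: "pointed e (Xmon e)"
  by (auto simp: pointed_def supp_above_def coeff_Xmon intro: exI[of _ 0])

lemma pointed_one: "pointed 0 1"
  using pointed_Xmon[of 0] by (simp add: Xmon_zero)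

lemma pointed_scale_tq: "pointed p x \<Longrightarrow> pointed p (tq i \<cdot> x)"
  by (auto simp: pointed_def supp_above_def simp flip: tq_add)

lemma pointed_diff:
  assumes "pointed p x" "supp_above r y" "p \<preceq> r" "p \<noteq> r"
  shows "pointed p (x - y)"
proof -
  have "p \<notin> supp y"
    using assms(2-4) pt_le_antisym unfolding supp_above_def by blast
  then have "coeff y p = 0" by (simp add: in_supp_iff)
  then show ?thesis
    using assms supp_diff[of x y] by (auto simp: pointed_def supp_above_def intro: pt_le_trans)
qed

lemma pointed_mult:
  assumes "pointed p x" "pointed r y"
  shows "pointed (p + r) (x * y)"
proof -
  have above: "p \<preceq> e" "r \<preceq> f" if "e \<in> supp x" "f \<in> supp y" for e f
    using assms that by (auto simp: pointed_def supp_above_def)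
  have "coeff (x * y) (p + r) = coeff x p * coeff y r * tq (lam p r)"
    by (rule coeff_mult_unique) (use above in \<open>fastforce simp: pt_le_def prod_eq_iff\<close>)
  then have "\<exists>i. coeff (x * y) (p + r) = tq i"
    using assms by (auto simp: pointed_def simp flip: tq_add)
  then show ?thesis using assms by (simp add: pointed_def supp_above_mult)
qed

definition scale_pt :: "nat \<Rightarrow> int \<times> int \<Rightarrow> int \<times> int" where
  "scale_pt n p = (int n * fst p, int n * snd p)"

lemma scale_pt_0 [simp]: "scale_pt 0 p = 0"
  and scale_pt_Suc: "scale_pt (Suc n) p = p + scale_pt n p"
  by (simp_all add: scale_pt_def prod_eq_iff algebra_simps)

lemma lam_scale_pt: "lam (scale_pt n p) r = int n * lam p r" "lam p (scale_pt n r) = int n * lam p r"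
  by (simp_all add: lam_def scale_pt_def algebra_simps)

lemma scale_pt_combination_inject:
  assumes "lam p r \<noteq> 0" and eq: "scale_pt a p + scale_pt b r = scale_pt a' p + scale_pt b' r"
  shows "a = a' \<and> b = b'"
  using assms(1) arg_cong[OF eq, of "\<lambda>v. lam v r"] arg_cong[OF eq, of "lam p"]
  by (simp add: lam_add_left lam_add_right lam_scale_pt)

lemma pointed_power: "pointed p x \<Longrightarrow> pointed (scale_pt n p) (x ^ n)"
  by (induction n) (simp_all add: pointed_one scale_pt_Suc pointed_mult)

lemma pointed_sum_in_supp:
  assumes "finite I" "inj_on pt I" and pointed: "\<And>i. i \<in> I \<Longrightarrow> pointed (pt i) (f i)"
    and "i \<in> I" "c i \<noteq> 0"
  obtains j where "j \<in> I" "pt j \<in> supp (\<Sum>i\<in>I. c i \<cdot> f i)" "pt j \<preceq> pt i"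
proof -
  define T where "T = {j \<in> I. c j \<noteq> 0 \<and> pt j \<preceq> pt i}"
  define h where "h j = fst (pt j) + snd (pt j)" for j
  have "finite T" "i \<in> T" using assms by (simp_all add: T_def)
  then obtain j where j_in_T: "j \<in> T" and h_min: "\<And>k. k \<in> T \<Longrightarrow> h j \<le> h k"
    using arg_min_if_finite[of T h] by (metis empty_iff linorder_not_less)
  have "coeff (\<Sum>i\<in>I. c i \<cdot> f i) (pt j) = (\<Sum>k\<in>I. if k = j then c j * coeff (f j) (pt j) else 0)"
    unfolding coeff_sum
  proof (rule sum.cong)
    fix k assume k_in_I: "k \<in> I"
    have "k = j" if nonzero: "c k * coeff (f k) (pt j) \<noteq> 0"
    proof -
      have below: "pt k \<preceq> pt j" using pointed[OF k_in_I] nonzero by (auto simp: pointed_def supp_above_def in_supp_iff)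
      then have "k \<in> T" using j_in_T k_in_I nonzero pt_le_trans by (auto simp: T_def)
      then have "pt k = pt j" using h_min[of k] below by (auto simp: h_def pt_le_def prod_eq_iff)
      then show ?thesis using j_in_T k_in_I \<open>inj_on pt I\<close> by (auto simp: T_def inj_on_def)
    qed
    then show "coeff (c k \<cdot> f k) (pt j) = (if k = j then c j * coeff (f j) (pt j) else 0)" by auto
  qed simp
  also have "\<dots> \<noteq> 0"
    using j_in_T \<open>finite I\<close> pointed[of j] by (auto simp: T_def pointed_def)
  finally have "pt j \<in> supp (\<Sum>i\<in>I. c i \<cdot> f i)" by (simp add: in_supp_iff)
  then show ?thesis using that[of j] j_in_T by (simp add: T_def)
qed

lemma in_span_pointed_family:
  assumes pointed_f: "\<And>p. pointed p (f p)" and y_in_span: "y \<in> torus.span (range f)"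
  shows "y \<in> torus.span (f ` {q. \<exists>r\<in>supp y. r \<preceq> q})"
proof -
  have inj_f: "inj f"
  proof (rule injI)
    fix p q assume "f p = f q"
    then show "p = q" using pointed_f[of p] pointed_f[of q] by (simp add: pointed_unique)
  qed
  obtain T c where T_sum: "finite T" "T \<subseteq> range f" "y = (\<Sum>a\<in>T. c a \<cdot> a)"
    using y_in_span by (auto simp: torus.span_explicit)
  then obtain S where T_eq: "finite S" "T = f ` S" using finite_subset_image[OF T_sum(1,2)] by blast
  have y_eq: "y = (\<Sum>q\<in>S. c (f q) \<cdot> f q)"
    using T_sum(3) T_eq inj_f by (simp add: sum.reindex inj_on_subset)
  have "c (f q) \<cdot> f q \<in> torus.span (f ` {q. \<exists>r\<in>supp y. r \<preceq> q})" if q_in_S: "q \<in> S" for q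
  proof (cases "c (f q) = 0")
    case False
    obtain r where "r \<in> supp y" "r \<preceq> q"
    proof (rule pointed_sum_in_supp[of S "\<lambda>q. q" f q "\<lambda>q. c (f q)"])
    qed (use T_eq(1) pointed_f q_in_S False y_eq in auto)
    then show ?thesis by (intro torus.span_scale torus.span_base) auto
  qed (simp add: torus.span_zero)
  then show ?thesis by (subst y_eq) (rule torus.span_sum)
qed

fun chebyshev :: "nat \<Rightarrow> 'a::ring_1 \<Rightarrow> 'a" where
  "chebyshev 0 x = 1"
| "chebyshev (Suc 0) x = x"
| "chebyshev (Suc (Suc 0)) x = x * x - 2"
| "chebyshev (Suc (Suc (Suc n))) x = chebyshev (Suc (Suc n)) x * x - chebyshev (Suc n) x"

lemma pointed_chebyshev:
  assumes pointed_x: "pointed p x" and p_below_0: "p \<preceq> 0" "p \<noteq> 0"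
  shows "pointed (scale_pt n p) (chebyshev n x)"
  using pointed_x
proof (induction n x rule: chebyshev.induct)
  case (1 x)
  show ?case by (simp add: pointed_one)
next
  case (2 x)
  then show ?case by (simp add: scale_pt_Suc)
next
  case (3 x)
  have "supp_above 0 (1 + 1)"
    using pointed_supp_above[OF pointed_one] supp_add[of 1 1] by (auto simp: supp_above_def)
  moreover have "p + p \<preceq> 0" "p + p \<noteq> 0"
    using p_below_0 by (auto simp: pt_le_def prod_eq_iff)
  ultimately show ?case
    using pointed_diff[OF pointed_mult[OF 3 3], of 0 2] by (simp add: scale_pt_Suc)
next
  case (4 n x)
  have "scale_pt (Suc (Suc n)) p + p = scale_pt (Suc (Suc (Suc n))) p"
    by (simp add: scale_pt_Suc ac_simps)
  moreover have "scale_pt (Suc (Suc (Suc n))) p = scale_pt (Suc n) p + (p + p)"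
    by (simp add: scale_pt_Suc ac_simps)
  moreover have "p + p \<preceq> 0" "p + p \<noteq> 0"
    using p_below_0 by (auto simp: pt_le_def prod_eq_iff)
  ultimately show ?case
    using pointed_diff[OF pointed_mult[OF 4(1) 4(3)] pointed_supp_above[OF 4(2)]] 4(3)
    by (auto simp: pt_le_def add.assoc)
qed

lemma pointed_X_delta: "pointed (-1, -2) X_delta"
  by (auto simp: X_delta_eq pointed_def supp_above_def in_supp_iff coeff_Xmon pt_le_def
      split: if_splits intro: exI[of _ 0])

definition parity_wt :: "int \<Rightarrow> int" where
  "parity_wt k = (if even k then 1 else 2)"

lemma parity_wt_pos [simp]: "parity_wt k > 0"
  and parity_wt_nonzero [simp]: "parity_wt k \<noteq> 0"
  by (simp_all add: parity_wt_def)

text \<open>The exponent at which \<open>X_k\<close> is pointed is minus its denominator vector.\<close>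

definition Xvar_pt :: "int \<Rightarrow> int \<times> int" where
  "Xvar_pt k = (if k \<ge> 2 then (parity_wt k * (2 - k) div 2, parity_wt k * (3 - k))
     else (parity_wt k * k div 2, parity_wt k * (k - 1)))"

lemma pointed_Xeven_run:
  assumes "\<bar>s\<bar> = 1" "pointed p (Xeven j)" "pointed r (Xeven (j - s))"
    and "p + (-1, -2) \<preceq> r" "p + (-1, -2) \<noteq> r"
  shows "pointed (p + scale_pt n (-1, -2)) (Xeven (j + s * int n))"
  using assms(2-)
proof (induction n arbitrary: j p r)
  case (Suc n)
  have "pointed ((-1, -2) + p) (Xeven (j + s))"
    unfolding Xeven_recurrence[OF assms(1)] using Suc.prems
    by (intro pointed_diff[where r = r] pointed_scale_tq pointed_mult pointed_X_delta pointed_supp_above)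
       (simp_all add: add.commute)
  then have "pointed ((-1, -2) + p + scale_pt n (-1, -2)) (Xeven (j + s + s * int n))"
    using Suc.prems by (intro Suc.IH[where r = p]) (simp_all add: pt_le_def prod_eq_iff)
  then show ?case by (simp add: scale_pt_Suc algebra_simps)
qed simp

lemma pointed_Xeven: "pointed (Xvar_pt (2 * j)) (Xeven j)"
proof -
  have pointed_X0: "pointed (0, -1) (Xeven 0)"
    by (auto simp: Xeven_0 pointed_def supp_above_def in_supp_iff coeff_Xmon pt_le_def
        split: if_splits intro: exI[of _ 0])
  have pointed_X2: "pointed (0, 1) (Xeven 1)"
    by (simp add: Xeven_1 pointed_Xmon)
  show ?thesis
  proof (cases "j \<ge> 1")
    case True
    have "pointed ((0, 1) + scale_pt (nat (j - 1)) (-1, -2)) (Xeven (1 + 1 * int (nat (j - 1))))"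
      by (rule pointed_Xeven_run[where r = "(0, -1)"]) (use pointed_X0 pointed_X2 in \<open>simp_all add: pt_le_def\<close>)
    then show ?thesis using True by (simp add: Xvar_pt_def parity_wt_def scale_pt_def algebra_simps)
  next
    case False
    have "pointed ((0, -1) + scale_pt (nat (- j)) (-1, -2)) (Xeven (0 + -1 * int (nat (- j))))"
      by (rule pointed_Xeven_run[where r = "(0, 1)"]) (use pointed_X0 pointed_X2 in \<open>simp_all add: pt_le_def\<close>)
    then show ?thesis using False by (simp add: Xvar_pt_def parity_wt_def scale_pt_def algebra_simps)
  qed
qed

theorem pointed_Xvar: "pointed (Xvar_pt k) (Xvar k)"
proof (cases "even k")
  case True
  then show ?thesis by (metis evenE Xvar_even pointed_Xeven)
next
  case False
  then obtain j where k_eq: "k = 2 * j + 1" by (elim oddE)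
  show ?thesis
  proof (cases "j = 0")
    case True
    then show ?thesis by (simp add: k_eq Xvar_1 Xvar_pt_def parity_wt_def pointed_Xmon)
  next
    case False
    have pt_sum: "Xvar_pt (2 * j) + Xvar_pt (2 * (j + 1)) = Xvar_pt (2 * j + 1)"
      using False by (auto simp: Xvar_pt_def parity_wt_def)
    have "pointed (Xvar_pt (2 * j + 1)) (Xeven j * Xeven (j + 1))"
      using pointed_mult[OF pointed_Xeven[of j] pointed_Xeven[of "j + 1"]] unfolding pt_sum .
    then show ?thesis
      unfolding k_eq Xvar_odd using False
      by (intro pointed_scale_tq pointed_diff[where r = 0] pointed_supp_above[OF pointed_one])
         (auto simp: Xvar_pt_def parity_wt_def pt_le_def zero_prod_def)
  qed
qed

lemma Xvar_nonzero [simp]: "Xvar k \<noteq> 0"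
  using pointed_Xvar pointed_nonzero by blast

lemma lam_Xvar_pt:
  assumes "\<bar>s\<bar> = 1"
  shows "lam (Xvar_pt k) (Xvar_pt (k + s)) = s"
proof -
  have half: "- (b * 2) div 2 = - b" for b :: int by presburger
  have "lam (Xvar_pt k) (Xvar_pt (k + 1)) = 1" for k
    by (cases "even k"; elim evenE oddE)
       (auto simp: Xvar_pt_def parity_wt_def lam_def half algebra_simps)
  from this[of k] this[of "k - 1"] show ?thesis
    using assms by (cases "s = 1") (auto simp: abs_if lam_def algebra_simps split: if_splits)
qed

section \<open>The cluster algebra\<close>

theorem exchange_sequence_unique:
  assumes "S 1 = Xvar 1" "S 2 = Xvar 2"
    and exchange: "\<And>k. S (k - 1) * S (k + 1) = tq (int (exch_exp k)) \<cdot> S k ^ exch_exp k + 1"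
  shows "S k = Xvar k"
proof (induction k rule: int_bidirectional_induct[where k = 1])
  case (step j s)
  from \<open>\<bar>s\<bar> = 1\<close> have "s = 1 \<or> s = -1" by linarith
  moreover have "S (j - 1) * S (j + 1) = Xvar (j - 1) * Xvar (j + 1)"
    using exchange[of j] Xvar_exchange[of 1 j] step(3) by simp
  ultimately show ?case using step(2) by auto
qed (use assms in simp_all)

lemma qtorus_of_power: "tpow (qtorus_of x) n = qtorus_of (x ^ n)"
  by (induction n)
     (simp_all add: tpow_def one_torus.rep_eq times_torus.rep_eq power_Suc2 del: power_Suc)

lemmas qtorus_of_simps = qtorus_of_power one_torus.rep_eq[symmetric] times_torus.rep_eq[symmetric]
  plus_torus.rep_eq[symmetric] minus_torus.rep_eq[symmetric] scale.rep_eq[symmetric]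
  Xmon.rep_eq[symmetric] X_delta.rep_eq[symmetric] qtorus_of_inject

lemma clrec_qtorus_of_iff:
  "clrec (\<lambda>k. qtorus_of (S k)) \<longleftrightarrow> S 1 = Xvar 1 \<and> S 2 = Xvar 2 \<and>
     (\<forall>k. S (k - 1) * S (k + 1) = tq (int (exch_exp k)) \<cdot> S k ^ exch_exp k + 1)"
  by (auto simp: clrec_def qtorus_of_simps Xvar_1 Xvar_2 exch_exp_def)

theorem Xc_eq: "Xc k = qtorus_of (Xvar k)"
proof -
  have "Xc = (\<lambda>k. qtorus_of (Xvar k))"
    unfolding Xc_def
  proof (rule the_equality)
    show "clrec (\<lambda>k. qtorus_of (Xvar k))"
      using Xvar_exchange[of 1] by (simp add: clrec_qtorus_of_iff)
    fix S assume clrec_S: "clrec S"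
    define T where "T k = torus_of (S k)" for k
    have S_eq: "S = (\<lambda>k. qtorus_of (T k))" by (simp add: T_def torus_of_inverse)
    have "T k = Xvar k" for k
      using clrec_S unfolding S_eq clrec_qtorus_of_iff by (metis exchange_sequence_unique)
    then show "S = (\<lambda>k. qtorus_of (Xvar k))" by (simp add: S_eq)
  qed
  then show ?thesis by (rule fun_cong)
qed

definition subalgebra :: "torus set \<Rightarrow> bool" where
  "subalgebra L \<longleftrightarrow> 1 \<in> L \<and> (\<forall>x\<in>L. \<forall>y\<in>L. x + y \<in> L \<and> x * y \<in> L) \<and> (\<forall>c. \<forall>x\<in>L. c \<cdot> x \<in> L)"

lemma subalgebra_one: "subalgebra L \<Longrightarrow> 1 \<in> L"
  and subalgebra_add: "subalgebra L \<Longrightarrow> x \<in> L \<Longrightarrow> y \<in> L \<Longrightarrow> x + y \<in> L"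
  and subalgebra_mult: "subalgebra L \<Longrightarrow> x \<in> L \<Longrightarrow> y \<in> L \<Longrightarrow> x * y \<in> L"
  and subalgebra_scale: "subalgebra L \<Longrightarrow> x \<in> L \<Longrightarrow> c \<cdot> x \<in> L"
  by (simp_all add: subalgebra_def)

lemma subalgebra_diff: "subalgebra L \<Longrightarrow> x \<in> L \<Longrightarrow> y \<in> L \<Longrightarrow> x - y \<in> L"
  using subalgebra_add[of L x "(-1) \<cdot> y"] subalgebra_scale[of L y "-1"]
  by (simp add: scale_minus_left)

lemma subalgebra_power: "subalgebra L \<Longrightarrow> x \<in> L \<Longrightarrow> x ^ n \<in> L"
  by (induction n) (simp_all add: subalgebra_one subalgebra_mult)

lemmas subalgebra_closed = subalgebra_one subalgebra_add subalgebra_mult subalgebra_scale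
  subalgebra_diff subalgebra_power

lemma subalgebra_chebyshev: "subalgebra L \<Longrightarrow> x \<in> L \<Longrightarrow> chebyshev n x \<in> L"
proof (induction n x rule: chebyshev.induct)
  case (3 x)
  then have "x * x - (1 + 1) \<in> L" by (simp only: subalgebra_closed)
  then show ?case by simp
qed (simp_all add: subalgebra_closed)

lemma Xvar_in_subalgebra:
  assumes subalgebra_L: "subalgebra L" and gen: "Xvar 0 \<in> L" "Xvar 2 \<in> L" "Xvar 3 \<in> L"
  shows "X_delta \<in> L" "Xvar k \<in> L"
proof -
  have generators: "Xeven 0 \<in> L" "Xeven 1 \<in> L" "Xvar 3 \<in> L"
    using gen Xvar_even[of 0] Xvar_even[of 1] by simp_all
  have "Xeven 2 = tq 1 \<cdot> (Xeven 0 * Xvar 3) - tq 4 \<cdot> (Xeven 1 * (Xeven 1 * Xeven 1))"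
    by (simp add: Xeven_0 Xeven_1 Xeven_2 Xvar_3 scale_algebra_simps Xmon_mult lam_def)
  then have "Xeven 2 \<in> L" using generators subalgebra_L by (simp add: subalgebra_closed)
  then show X_delta: "X_delta \<in> L"
    using generators subalgebra_L by (subst X_delta_eq_Xeven[of 1 1]) (simp_all add: subalgebra_closed)
  have even: "Xeven j \<in> L" for j
    by (induction j rule: int_bidirectional_induct[where k = 0])
       (use generators X_delta subalgebra_L in \<open>simp_all add: Xeven_recurrence subalgebra_closed\<close>)
  then show "Xvar k \<in> L"
    using subalgebra_L by (simp add: Xvar_def subalgebra_closed)
qed

definition cluster_algebra :: "torus set" where
  "cluster_algebra = {x. qtorus_of x \<in> Aq}"

lemma subalgebra_cluster_algebra: "subalgebra cluster_algebra"
  using Aq.intros unfolding subalgebra_def cluster_algebra_def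
  by (auto simp: one_torus.rep_eq plus_torus.rep_eq times_torus.rep_eq scale.rep_eq)

lemma Xvar_in_cluster_algebra: "Xvar k \<in> cluster_algebra"
  using Aq.gen[of k] by (simp add: cluster_algebra_def Xc_eq)

lemma cluster_algebra_subset:
  assumes subalgebra_L: "subalgebra L" and Xvar_in_L: "\<And>k. Xvar k \<in> L"
  shows "cluster_algebra \<subseteq> L"
proof -
  have "\<exists>x\<in>L. y = qtorus_of x" if "y \<in> Aq" for y
    using that
  proof induction
    case (gen k)
    then show ?case using Xvar_in_L[of k] Xc_eq[of k] by blast
  next
    case one
    then show ?case using subalgebra_one[OF subalgebra_L] one_torus.rep_eq by metis
  next
    case (add x y)
    then show ?case using subalgebra_add[OF subalgebra_L] plus_torus.rep_eq by metis
  next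
    case (mult x y)
    then show ?case using subalgebra_mult[OF subalgebra_L] times_torus.rep_eq by metis
  next
    case (smul x c)
    then show ?case using subalgebra_scale[OF subalgebra_L] scale.rep_eq by metis
  qed
  then show ?thesis by (force simp: cluster_algebra_def qtorus_of_inject)
qed

section \<open>Standard monomials\<close>

definition left_stabilizer :: "torus set \<Rightarrow> torus set" where
  "left_stabilizer V = {x. \<forall>v\<in>V. x * v \<in> V}"

lemma left_stabilizerD: "x \<in> left_stabilizer V \<Longrightarrow> v \<in> V \<Longrightarrow> x * v \<in> V"
  by (simp add: left_stabilizer_def)

lemma subalgebra_left_stabilizer: "torus.subspace V \<Longrightarrow> subalgebra (left_stabilizer V)"
  by (simp add: subalgebra_def left_stabilizer_def torus.subspace_add torus.subspace_scale
      distrib_right mult.assoc)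

lemma left_stabilizer_spanI:
  assumes "\<And>b. b \<in> B \<Longrightarrow> x * b \<in> torus.span B"
  shows "x \<in> left_stabilizer (torus.span B)"
proof -
  have "x * v \<in> torus.span B" if "v \<in> torus.span B" for v
    using that
  proof (induction v rule: torus.span_induct_alt)
    case (step c b v)
    then show ?case
      using assms[of b] by (simp add: distrib_left torus.span_add torus.span_scale)
  qed (simp add: torus.span_zero)
  then show ?thesis by (simp add: left_stabilizer_def)
qed

definition ordered_mon :: "nat \<Rightarrow> nat \<Rightarrow> nat \<Rightarrow> nat \<Rightarrow> torus" where
  "ordered_mon a b c d = Xvar 0 ^ a * Xvar 1 ^ b * Xvar 2 ^ c * Xvar 3 ^ d"

definition ordered_span :: "torus set" where
  "ordered_span = torus.span {ordered_mon a b c d | a b c d. True}"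

lemma subspace_ordered_span: "torus.subspace ordered_span"
  unfolding ordered_span_def by (rule torus.subspace_span)

lemma ordered_mon_in_ordered_span: "ordered_mon a b c d \<in> ordered_span"
  unfolding ordered_span_def by (rule torus.span_base) auto

lemmas ordered_span_intros = torus.subspace_add[OF subspace_ordered_span]
  torus.subspace_scale[OF subspace_ordered_span] ordered_mon_in_ordered_span

lemma left_stabilizer_ordered_spanI:
  assumes "\<And>a b c d. x * ordered_mon a b c d \<in> ordered_span"
  shows "x \<in> left_stabilizer ordered_span"
  using assms unfolding ordered_span_def by (intro left_stabilizer_spanI) auto

lemma Xvar_0_left_stabilizer: "Xvar 0 \<in> left_stabilizer ordered_span"
proof (rule left_stabilizer_ordered_spanI)
  fix a b c d
  have "Xvar 0 * ordered_mon a b c d = ordered_mon (Suc a) b c d"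
    by (simp add: ordered_mon_def mult.assoc)
  then show "Xvar 0 * ordered_mon a b c d \<in> ordered_span" by (simp only: ordered_span_intros)
qed

lemma Xvar_1_left_stabilizer: "Xvar 1 \<in> left_stabilizer ordered_span"
proof (rule left_stabilizer_ordered_spanI)
  fix a b c d
  have "Xvar 1 * ordered_mon a b c d = (Xvar 1 * Xvar 0 ^ a) * (Xvar 1 ^ b * Xvar 2 ^ c * Xvar 3 ^ d)"
    by (simp add: ordered_mon_def mult.assoc)
  also have "Xvar 1 * Xvar 0 ^ a = tq (- 2 * int a) \<cdot> (Xvar 0 ^ a * Xvar 1)"
    using Xvar_qcommute[of "-1" 1] by (intro qcommute_power_right) simp
  finally have "Xvar 1 * ordered_mon a b c d = tq (- 2 * int a) \<cdot> ordered_mon a (Suc b) c d"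
    by (simp add: ordered_mon_def mult.assoc)
  then show "Xvar 1 * ordered_mon a b c d \<in> ordered_span" by (simp only: ordered_span_intros)
qed

lemma Xvar_2_left_stabilizer: "Xvar 2 \<in> left_stabilizer ordered_span"
proof (rule left_stabilizer_ordered_spanI)
  fix a b c d
  show "Xvar 2 * ordered_mon a b c d \<in> ordered_span"
  proof (cases a)
    case 0
    have "Xvar 2 * ordered_mon 0 b c d = (Xvar 2 * Xvar 1 ^ b) * (Xvar 2 ^ c * Xvar 3 ^ d)"
      by (simp add: ordered_mon_def mult.assoc)
    also have "Xvar 2 * Xvar 1 ^ b = tq (- 2 * int b) \<cdot> (Xvar 1 ^ b * Xvar 2)"
      using Xvar_qcommute[of "-1" 2] by (intro qcommute_power_right) simp
    finally have "Xvar 2 * ordered_mon 0 b c d = tq (- 2 * int b) \<cdot> ordered_mon 0 b (Suc c) d"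
      by (simp add: ordered_mon_def mult.assoc)
    then show ?thesis using 0 by (simp only: ordered_span_intros)
  next
    case (Suc a')
    have "Xvar 2 * ordered_mon (Suc a') b c d = (Xvar 2 * Xvar 0) * ordered_mon a' b c d"
      by (simp add: ordered_mon_def mult.assoc)
    also have "Xvar 2 * Xvar 0 = tq (-1) \<cdot> Xvar 1 + 1"
      using Xvar_exchange[of "-1" 1] by (simp add: exch_exp_def)
    finally have "Xvar 2 * ordered_mon (Suc a') b c d =
        tq (-1) \<cdot> (Xvar 1 * ordered_mon a' b c d) + ordered_mon a' b c d"
      by (simp add: distrib_right)
    then show ?thesis
      using Suc by (simp only: ordered_span_intros left_stabilizerD[OF Xvar_1_left_stabilizer])
  qed
qed

lemma Xvar_2_power_left_stabilizer: "Xvar 2 ^ n \<in> left_stabilizer ordered_span"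
  by (intro subalgebra_power subalgebra_left_stabilizer subspace_ordered_span Xvar_2_left_stabilizer)

lemma Xvar_3_mult_ordered_mon_0: "Xvar 3 * ordered_mon 0 b c d \<in> ordered_span"
proof (cases b)
  case 0
  have "Xvar 3 * ordered_mon 0 0 c d = (Xvar 3 * Xvar 2 ^ c) * Xvar 3 ^ d"
    by (simp add: ordered_mon_def mult.assoc)
  also have "Xvar 3 * Xvar 2 ^ c = tq (- 2 * int c) \<cdot> (Xvar 2 ^ c * Xvar 3)"
    using Xvar_qcommute[of "-1" 3] by (intro qcommute_power_right) simp
  finally have "Xvar 3 * ordered_mon 0 0 c d = tq (- 2 * int c) \<cdot> ordered_mon 0 0 c (Suc d)"
    by (simp add: ordered_mon_def mult.assoc)
  then show ?thesis using 0 by (simp only: ordered_span_intros)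
next
  case (Suc b')
  have "Xvar 3 * ordered_mon 0 (Suc b') c d = (Xvar 3 * Xvar 1) * ordered_mon 0 b' c d"
    by (simp add: ordered_mon_def mult.assoc)
  also have "Xvar 3 * Xvar 1 = tq (-4) \<cdot> Xvar 2 ^ 4 + 1"
    using Xvar_exchange[of "-1" 2] by (simp add: exch_exp_def)
  finally have "Xvar 3 * ordered_mon 0 (Suc b') c d =
      tq (-4) \<cdot> (Xvar 2 ^ 4 * ordered_mon 0 b' c d) + ordered_mon 0 b' c d"
    by (simp add: distrib_right)
  then show ?thesis
    using Suc by (simp only: ordered_span_intros left_stabilizerD[OF Xvar_2_power_left_stabilizer])
qed

lemma Xvar_3_left_stabilizer: "Xvar 3 \<in> left_stabilizer ordered_span"
proof (rule left_stabilizer_ordered_spanI)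
  fix a b c d
  show "Xvar 3 * ordered_mon a b c d \<in> ordered_span"
  proof (induction a)
    case 0
    show ?case by (rule Xvar_3_mult_ordered_mon_0)
  next
    case (Suc a)
    have "Xvar 3 * ordered_mon (Suc a) b c d = (Xvar 3 * Xvar 0) * ordered_mon a b c d"
      by (simp add: ordered_mon_def mult.assoc)
    also have "Xvar 3 * Xvar 0 = tq 2 \<cdot> (Xvar 0 * Xvar 3) + (tq (-3) - tq 5) \<cdot> Xvar 2 ^ 3"
      by (simp add: Xvar_0 Xvar_2 Xvar_3 scale_algebra_simps Xmon_mult lam_def power3_eq_cube)
    finally have "Xvar 3 * ordered_mon (Suc a) b c d = tq 2 \<cdot> (Xvar 0 * (Xvar 3 * ordered_mon a b c d))
        + (tq (-3) - tq 5) \<cdot> (Xvar 2 ^ 3 * ordered_mon a b c d)"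
      by (simp add: distrib_right mult.assoc)
    then show ?case
      by (simp only: ordered_span_intros Suc left_stabilizerD[OF Xvar_0_left_stabilizer]
          left_stabilizerD[OF Xvar_2_power_left_stabilizer])
  qed
qed

definition standard_mon :: "int \<times> int \<Rightarrow> torus" where
  "standard_mon p = ordered_mon (nat (- snd p)) (nat (fst p)) (nat (snd p)) (nat (- fst p))"

lemma ordered_mon_straighten_02:
  "ordered_mon (Suc a) b (Suc c) d =
     tq (2 * int b) \<cdot> (tq 1 \<cdot> ordered_mon a (Suc b) c d + ordered_mon a b c d)"
proof -
  have "ordered_mon (Suc a) b (Suc c) d = Xvar 0 ^ a * (Xvar 0 * Xvar 1 ^ b) * Xvar 2 * Xvar 2 ^ c * Xvar 3 ^ d"
    by (simp only: ordered_mon_def power_Suc2[of "Xvar 0"] power_Suc[of "Xvar 2"] mult.assoc)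
  also have "Xvar 0 * Xvar 1 ^ b = tq (2 * int b) \<cdot> (Xvar 1 ^ b * Xvar 0)"
    using Xvar_qcommute[of 1 0] by (intro qcommute_power_right) simp
  also have "Xvar 0 ^ a * (tq (2 * int b) \<cdot> (Xvar 1 ^ b * Xvar 0)) * Xvar 2 * Xvar 2 ^ c * Xvar 3 ^ d =
      tq (2 * int b) \<cdot> (Xvar 0 ^ a * Xvar 1 ^ b * (Xvar 0 * Xvar 2) * Xvar 2 ^ c * Xvar 3 ^ d)"
    by (simp add: mult.assoc)
  also have "Xvar 0 * Xvar 2 = tq 1 \<cdot> Xvar 1 + 1"
    using Xvar_exchange[of 1 1] by (simp add: exch_exp_def)
  finally show ?thesis
    by (simp add: ordered_mon_def distrib_left distrib_right mult.assoc power_Suc2 del: power_Suc)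
qed

lemma ordered_mon_straighten_13:
  "ordered_mon a (Suc b) c (Suc d) =
     tq (2 * int c) \<cdot> (tq 4 \<cdot> ordered_mon a b (c + 4) d + ordered_mon a b c d)"
proof -
  have "ordered_mon a (Suc b) c (Suc d) = Xvar 0 ^ a * Xvar 1 ^ b * (Xvar 1 * Xvar 2 ^ c) * Xvar 3 * Xvar 3 ^ d"
    by (simp only: ordered_mon_def power_Suc2[of "Xvar 1"] power_Suc[of "Xvar 3"] mult.assoc)
  also have "Xvar 1 * Xvar 2 ^ c = tq (2 * int c) \<cdot> (Xvar 2 ^ c * Xvar 1)"
    using Xvar_qcommute[of 1 1] by (intro qcommute_power_right) simp
  also have "Xvar 0 ^ a * Xvar 1 ^ b * (tq (2 * int c) \<cdot> (Xvar 2 ^ c * Xvar 1)) * Xvar 3 * Xvar 3 ^ d =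
      tq (2 * int c) \<cdot> (Xvar 0 ^ a * Xvar 1 ^ b * Xvar 2 ^ c * (Xvar 1 * Xvar 3) * Xvar 3 ^ d)"
    by (simp add: mult.assoc)
  also have "Xvar 1 * Xvar 3 = tq 4 \<cdot> Xvar 2 ^ 4 + 1"
    using Xvar_exchange[of 1 2] by (simp add: exch_exp_def)
  finally show ?thesis
    by (simp add: ordered_mon_def distrib_left distrib_right mult.assoc power_add)
qed

lemma ordered_mon_in_span_standard: "ordered_mon a b c d \<in> torus.span (range standard_mon)"
proof (induction "a + d" arbitrary: a b c d rule: less_induct)
  case less
  consider (ac) a' c' where "a = Suc a'" "c = Suc c'" | (bd) b' d' where "b = Suc b'" "d = Suc d'"
    | (standard) "a = 0 \<or> c = 0" "b = 0 \<or> d = 0"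
    by (metis not0_implies_Suc)
  then show ?case
  proof cases
    case ac
    then show ?thesis
      unfolding ac ordered_mon_straighten_02
      by (intro torus.span_scale torus.span_add less) (use ac in simp_all)
  next
    case bd
    then show ?thesis
      unfolding bd ordered_mon_straighten_13
      by (intro torus.span_scale torus.span_add less) (use bd in simp_all)
  next
    case standard
    then have "ordered_mon a b c d = standard_mon (int b - int d, int c - int a)"
      by (auto simp: standard_mon_def)
    then show ?thesis by (simp add: torus.span_base)
  qed
qed

lemma pointed_standard_mon: "pointed p (standard_mon p)"
proof -
  have "scale_pt (nat (- snd p)) (Xvar_pt 0) + scale_pt (nat (fst p)) (Xvar_pt 1)
      + scale_pt (nat (snd p)) (Xvar_pt 2) + scale_pt (nat (- fst p)) (Xvar_pt 3) = p"
    by (simp add: scale_pt_def Xvar_pt_def parity_wt_def prod_eq_iff)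
  moreover have "pointed (scale_pt (nat (- snd p)) (Xvar_pt 0) + scale_pt (nat (fst p)) (Xvar_pt 1)
      + scale_pt (nat (snd p)) (Xvar_pt 2) + scale_pt (nat (- fst p)) (Xvar_pt 3)) (standard_mon p)"
    unfolding standard_mon_def ordered_mon_def by (intro pointed_mult pointed_power pointed_Xvar)
  ultimately show ?thesis by simp
qed

theorem cluster_algebra_subset_span_standard: "cluster_algebra \<subseteq> torus.span (range standard_mon)"
proof
  fix x assume x_in_algebra: "x \<in> cluster_algebra"
  have stabilizer: "subalgebra (left_stabilizer ordered_span)"
    by (intro subalgebra_left_stabilizer subspace_ordered_span)
  then have "cluster_algebra \<subseteq> left_stabilizer ordered_span"
    using Xvar_in_subalgebra(2)[OF stabilizer Xvar_0_left_stabilizer Xvar_2_left_stabilizer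
        Xvar_3_left_stabilizer]
    by (rule cluster_algebra_subset)
  then have "x * ordered_mon 0 0 0 0 \<in> ordered_span"
    using x_in_algebra by (intro left_stabilizerD ordered_mon_in_ordered_span) auto
  then have "x \<in> ordered_span" by (simp add: ordered_mon_def)
  moreover have "ordered_span \<subseteq> torus.span (range standard_mon)"
    unfolding ordered_span_def by (rule torus.span_minimal) (auto simp: ordered_mon_in_span_standard)
  ultimately show "x \<in> torus.span (range standard_mon)" by blast
qed

section \<open>The basis\<close>

definition normal_mon :: "int \<Rightarrow> torus \<Rightarrow> torus \<Rightarrow> nat \<Rightarrow> nat \<Rightarrow> torus" where
  "normal_mon s x y a b = tq (- (s * (int a * int b))) \<cdot> (x ^ a * y ^ b)"

lemma power_mult_power_eq_normal_mon: "x ^ a * y ^ b = tq (s * (int a * int b)) \<cdot> normal_mon s x y a b"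
  by (simp add: normal_mon_def flip: tq_add)

lemma normal_mon_swap:
  "x * y = tq (2 * s) \<cdot> (y * x) \<Longrightarrow> normal_mon s x y a b = normal_mon (- s) y x b a"
  using qcommute_power[of x y "2 * s" a b] by (simp add: normal_mon_def algebra_simps flip: tq_add)

lemma normal_mon_mult:
  assumes "x * y = tq (2 * s) \<cdot> (y * x)"
  shows "normal_mon s x y a b * normal_mon s x y c d =
    tq (s * lam (int a, int b) (int c, int d)) \<cdot> normal_mon s x y (a + c) (b + d)"
proof -
  have swap: "y ^ b * x ^ c = tq (- (2 * s * int c * int b)) \<cdot> (x ^ c * y ^ b)"
    by (simp add: qcommute_power[OF assms, of c b] flip: tq_add)
  have "(x ^ a * y ^ b) * (x ^ c * y ^ d) = x ^ a * (y ^ b * x ^ c) * y ^ d"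
    by (simp add: mult.assoc)
  also have "\<dots> = tq (- (2 * s * int c * int b)) \<cdot> (x ^ (a + c) * y ^ (b + d))"
    unfolding swap by (simp add: power_add mult.assoc)
  finally show ?thesis
    by (simp add: normal_mon_def lam_def algebra_simps flip: tq_add)
qed

lemma pointed_normal_mon:
  "pointed p x \<Longrightarrow> pointed r y \<Longrightarrow> pointed (scale_pt a p + scale_pt b r) (normal_mon s x y a b)"
  unfolding normal_mon_def by (intro pointed_scale_tq pointed_mult pointed_power)

definition cluster_mon :: "int \<Rightarrow> nat \<Rightarrow> nat \<Rightarrow> torus" where
  "cluster_mon m = normal_mon 1 (Xvar m) (Xvar (m + 1))"

definition basis :: "torus set" where
  "basis = {cluster_mon m a b | m a b. True} \<union> {chebyshev n X_delta | n. n \<ge> 1}"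

lemma basis_cases:
  assumes "x \<in> basis"
  obtains (cluster) m a b where "x = cluster_mon m a b"
    | (cheb) n where "n \<ge> 1" "x = chebyshev n X_delta"
  using assms by (auto simp: basis_def)

lemma cluster_mon_in_basis: "cluster_mon m a b \<in> basis"
  and chebyshev_in_basis: "n \<ge> 1 \<Longrightarrow> chebyshev n X_delta \<in> basis"
  by (auto simp: basis_def)

lemma qtorus_of_chebyshev: "cheb n (qtorus_of x) = qtorus_of (chebyshev n x)"
proof (induction n x rule: chebyshev.induct)
  case (3 x)
  have "(2::torus) = 2 \<cdot> 1" using scale_add_left[of 1 1 1] by simp
  then show ?case by (simp add: qtorus_of_simps)
qed (simp_all add: qtorus_of_simps)

lemma Bset_eq: "Bset = qtorus_of ` basis"
  unfolding Bset_def basis_def image_Un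
  by (auto simp: cluster_mon_def normal_mon_def Xc_eq qtorus_of_chebyshev qtorus_of_simps)

lemma basis_subset_cluster_algebra: "basis \<subseteq> cluster_algebra"
proof
  note subalgebra = subalgebra_cluster_algebra
  fix x assume "x \<in> basis"
  then show "x \<in> cluster_algebra"
  proof (cases rule: basis_cases)
    case cluster
    then show ?thesis
      using subalgebra by (simp add: cluster_mon_def normal_mon_def subalgebra_closed Xvar_in_cluster_algebra)
  next
    case cheb
    then show ?thesis
      using subalgebra by (simp add: subalgebra_chebyshev Xvar_in_subalgebra(1) Xvar_in_cluster_algebra)
  qed
qed

definition cluster_pt :: "int \<Rightarrow> nat \<Rightarrow> nat \<Rightarrow> int \<times> int" where
  "cluster_pt m a b = scale_pt a (Xvar_pt m) + scale_pt b (Xvar_pt (m + 1))"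

lemma pointed_cluster_mon: "pointed (cluster_pt m a b) (cluster_mon m a b)"
  unfolding cluster_pt_def cluster_mon_def by (intro pointed_normal_mon pointed_Xvar)

lemma twice_fst_Xvar_pt:
  "2 * fst (Xvar_pt k) = (if k \<ge> 2 then parity_wt k * (2 - k) else parity_wt k * k)"
  by (auto simp: Xvar_pt_def parity_wt_def)

lemma cluster_pt_coordinates:
  assumes "A = int a * parity_wt m" "B = int b * parity_wt (m + 1)"
  shows "m \<ge> 2 \<Longrightarrow> 2 * fst (cluster_pt m a b) = (2 - m) * A + (1 - m) * B \<and>
      snd (cluster_pt m a b) = (3 - m) * A + (2 - m) * B"
    and "m \<le> 0 \<Longrightarrow> 2 * fst (cluster_pt m a b) = m * A + (m + 1) * B \<and>
      snd (cluster_pt m a b) = (m - 1) * A + m * B"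
proof -
  have "2 * fst (cluster_pt m a b) = int a * (2 * fst (Xvar_pt m)) + int b * (2 * fst (Xvar_pt (m + 1)))"
    by (simp add: cluster_pt_def scale_pt_def algebra_simps)
  moreover have "snd (cluster_pt m a b) = int a * snd (Xvar_pt m) + int b * snd (Xvar_pt (m + 1))"
    by (simp add: cluster_pt_def scale_pt_def)
  ultimately show "m \<ge> 2 \<Longrightarrow> 2 * fst (cluster_pt m a b) = (2 - m) * A + (1 - m) * B \<and>
      snd (cluster_pt m a b) = (3 - m) * A + (2 - m) * B"
    and "m \<le> 0 \<Longrightarrow> 2 * fst (cluster_pt m a b) = m * A + (m + 1) * B \<and>
      snd (cluster_pt m a b) = (m - 1) * A + m * B"
    unfolding twice_fst_Xvar_pt assms by (simp_all add: Xvar_pt_def algebra_simps)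
qed

lemma parity_wt_multiples:
  assumes "A \<ge> 0" "B \<ge> 0" "even (m * A + (m + 1) * B)"
  obtains a b where "A = int a * parity_wt m" "B = int b * parity_wt (m + 1)"
proof -
  have "parity_wt m dvd A" "parity_wt (m + 1) dvd B"
    using assms(3) by (auto simp: parity_wt_def)
  then obtain a b where "A = a * parity_wt m" "B = b * parity_wt (m + 1)"
    by (metis dvd_div_mult_self)
  moreover from this have "a \<ge> 0" "b \<ge> 0"
    using assms(1,2) parity_wt_pos by (metis mult_neg_pos not_le)+
  ultimately show ?thesis using that[of "nat a" "nat b"] by simp
qed

text \<open>Both cones are exhausted by division with remainder: the quotient determines the cluster, the
  remainder and its complement the exponents.\<close>

lemma cluster_pt_exists_right:
  assumes "fst p < 0" "2 * fst p < snd p"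
  obtains m a b where "p = cluster_pt m a b"
proof -
  define D B where "D = snd p - 2 * fst p" and "B = (- 2 * fst p) mod D"
  define m where "m = (- 2 * fst p) div D + 2"
  have D_pos: "D > 0" using assms by (simp add: D_def)
  then have nonneg: "D - B \<ge> 0" "B \<ge> 0" by (simp_all add: B_def less_imp_le)
  have m_ge_2: "m \<ge> 2" using D_pos assms by (simp add: m_def pos_imp_zdiv_nonneg_iff)
  have quot: "- 2 * fst p = (m - 2) * D + B" by (simp add: m_def B_def)
  then have fst_p: "2 * fst p = (2 - m) * (D - B) + (1 - m) * B" by (simp add: algebra_simps)
  then have "even ((2 - m) * (D - B) + (1 - m) * B)" by (metis dvd_triv_left)
  then have "even (m * (D - B) + (m + 1) * B)" by auto
  then obtain a b where exponents: "D - B = int a * parity_wt m" "B = int b * parity_wt (m + 1)"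
    using nonneg parity_wt_multiples by metis
  have "snd p = D + 2 * fst p" by (simp add: D_def)
  then have "snd p = (3 - m) * (D - B) + (2 - m) * B" using fst_p by (simp add: algebra_simps)
  then have "p = cluster_pt m a b"
    using fst_p cluster_pt_coordinates(1)[OF exponents m_ge_2] by (simp add: prod_eq_iff)
  then show ?thesis by (rule that)
qed

lemma cluster_pt_exists_left:
  assumes "snd p < 0" "snd p < 2 * fst p"
  obtains m a b where "p = cluster_pt m a b"
proof -
  define D A where "D = 2 * fst p - snd p" and "A = (- snd p) mod D"
  define m where "m = - ((- snd p) div D)"
  have D_pos: "D > 0" using assms by (simp add: D_def)
  then have nonneg: "A \<ge> 0" "D - A \<ge> 0" by (simp_all add: A_def less_imp_le)
  have m_le_0: "m \<le> 0" using D_pos assms by (simp add: m_def pos_imp_zdiv_nonneg_iff)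
  have "- snd p = (- m) * D + A" by (simp add: m_def A_def)
  then have snd_p: "snd p = (m - 1) * A + m * (D - A)" by (simp add: algebra_simps)
  have "2 * fst p = D + snd p" by (simp add: D_def)
  then have fst_p: "2 * fst p = m * A + (m + 1) * (D - A)" using snd_p by (simp add: algebra_simps)
  then have "even (m * A + (m + 1) * (D - A))" by (metis dvd_triv_left)
  then obtain a b where exponents: "A = int a * parity_wt m" "D - A = int b * parity_wt (m + 1)"
    using nonneg parity_wt_multiples by metis
  have "p = cluster_pt m a b"
    using fst_p snd_p cluster_pt_coordinates(2)[OF exponents m_le_0] by (simp add: prod_eq_iff)
  then show ?thesis by (rule that)
qed

theorem pointed_basis_exists:
  assumes "fst p < 0" "snd p < 0"
  obtains x where "x \<in> basis" "pointed p x"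
proof -
  consider (right) "2 * fst p < snd p" | (left) "snd p < 2 * fst p" | (ray) "snd p = 2 * fst p"
    by linarith
  then show ?thesis
  proof cases
    case right
    then obtain m a b where "p = cluster_pt m a b" using assms cluster_pt_exists_right by metis
    then show ?thesis using that cluster_mon_in_basis pointed_cluster_mon by blast
  next
    case left
    then obtain m a b where "p = cluster_pt m a b" using assms cluster_pt_exists_left by metis
    then show ?thesis using that cluster_mon_in_basis pointed_cluster_mon by blast
  next
    case ray
    define n where "n = nat (- fst p)"
    have "p = scale_pt n (-1, -2)" "n \<ge> 1"
      using ray assms by (simp_all add: n_def scale_pt_def prod_eq_iff)
    moreover have "pointed (scale_pt n (-1, -2)) (chebyshev n X_delta)"
      by (intro pointed_chebyshev pointed_X_delta) (simp_all add: pt_le_def zero_prod_def)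
    ultimately show ?thesis using that chebyshev_in_basis by blast
  qed
qed

lemma Xvar_power_mult_in_span_basis: "Xvar m ^ a * Xvar (m + 1) ^ b \<in> torus.span basis"
  unfolding power_mult_power_eq_normal_mon[where s = 1] cluster_mon_def[symmetric]
  by (intro torus.span_scale torus.span_base cluster_mon_in_basis)

lemma standard_mon_triangular:
  assumes "fst p < 0" "snd p < 0"
  obtains x k where "x \<in> basis"
    "standard_mon p - tq k \<cdot> x \<in> torus.span (standard_mon ` {q. p \<preceq> q \<and> q \<noteq> p})"
proof -
  obtain x where pointed_x: "x \<in> basis" "pointed p x" using pointed_basis_exists[OF assms] .
  obtain i j where leading_coeffs: "coeff (standard_mon p) p = tq i" "coeff x p = tq j"
    using pointed_x(2) pointed_standard_mon[of p] by (auto simp: pointed_def)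
  define y where "y = standard_mon p - tq (i - j) \<cdot> x"
  have "standard_mon p \<in> cluster_algebra"
    using subalgebra_cluster_algebra
    by (simp add: standard_mon_def ordered_mon_def subalgebra_closed Xvar_in_cluster_algebra)
  then have "y \<in> cluster_algebra"
    using pointed_x(1) basis_subset_cluster_algebra subalgebra_cluster_algebra
    by (auto simp: y_def subalgebra_closed)
  then have y_span: "y \<in> torus.span (standard_mon ` {q. \<exists>r\<in>supp y. r \<preceq> q})"
    using cluster_algebra_subset_span_standard
    by (intro in_span_pointed_family pointed_standard_mon) auto
  have above: "p \<preceq> r \<and> r \<noteq> p" if r_in_supp: "r \<in> supp y" for r
  proof
    have "supp y \<subseteq> supp (standard_mon p) \<union> supp x"
      using supp_diff[of "standard_mon p" "tq (i - j) \<cdot> x"] by (simp add: y_def)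
    then show "p \<preceq> r"
      using r_in_supp pointed_x(2) pointed_standard_mon[of p] by (auto simp: pointed_def supp_above_def)
    have "coeff y p = 0" by (simp add: y_def leading_coeffs flip: tq_add)
    then show "r \<noteq> p" using r_in_supp by (auto simp: in_supp_iff)
  qed
  have "p \<preceq> q \<and> q \<noteq> p" if "r \<in> supp y" "r \<preceq> q" for r q
    using above[OF that(1)] that(2) by (metis pt_le_antisym pt_le_trans)
  then have "{q. \<exists>r\<in>supp y. r \<preceq> q} \<subseteq> {q. p \<preceq> q \<and> q \<noteq> p}" by blast
  then have "y \<in> torus.span (standard_mon ` {q. p \<preceq> q \<and> q \<noteq> p})"
    using y_span by (rule subsetD[OF torus.span_mono[OF image_mono]])
  with pointed_x(1) show ?thesis unfolding y_def by (rule that)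
qed

lemma standard_mon_in_span_basis: "standard_mon p \<in> torus.span basis"
proof (induction "nat (- fst p) + nat (- snd p)" arbitrary: p rule: less_induct)
  case less
  consider (cluster_1) "fst p \<ge> 0" "snd p \<ge> 0" | (cluster_0) "fst p \<ge> 0" "snd p \<le> 0"
    | (cluster_2) "fst p \<le> 0" "snd p \<ge> 0" | (negative) "fst p < 0" "snd p < 0" by linarith
  then show ?case
  proof cases
    case cluster_1
    then show ?thesis
      using Xvar_power_mult_in_span_basis[of 1 "nat (fst p)" "nat (snd p)"]
      by (simp add: standard_mon_def ordered_mon_def)
  next
    case cluster_0
    then show ?thesis
      using Xvar_power_mult_in_span_basis[of 0 "nat (- snd p)" "nat (fst p)"]
      by (simp add: standard_mon_def ordered_mon_def)
  next
    case cluster_2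
    then show ?thesis
      using Xvar_power_mult_in_span_basis[of 2 "nat (snd p)" "nat (- fst p)"]
      by (simp add: standard_mon_def ordered_mon_def)
  next
    case negative
    then obtain x k where x: "x \<in> basis"
      and y: "standard_mon p - tq k \<cdot> x \<in> torus.span (standard_mon ` {q. p \<preceq> q \<and> q \<noteq> p})"
      by (rule standard_mon_triangular)
    have "standard_mon q \<in> torus.span basis" if "p \<preceq> q" "q \<noteq> p" for q
      using that negative by (intro less) (auto simp: pt_le_def prod_eq_iff)
    then have "torus.span (standard_mon ` {q. p \<preceq> q \<and> q \<noteq> p}) \<subseteq> torus.span basis"
      by (intro torus.span_minimal torus.subspace_span) auto
    then have "standard_mon p - tq k \<cdot> x \<in> torus.span basis"
      using y by (rule subsetD)
    moreover have "tq k \<cdot> x \<in> torus.span basis"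
      using x by (intro torus.span_scale torus.span_base)
    ultimately have "(standard_mon p - tq k \<cdot> x) + tq k \<cdot> x \<in> torus.span basis"
      by (rule torus.span_add)
    then show ?thesis by simp
  qed
qed

theorem span_basis: "torus.span basis = cluster_algebra"
proof
  have "torus.subspace cluster_algebra"
    using subalgebra_cluster_algebra subalgebra_scale[of cluster_algebra 1 0]
    by (simp add: torus.subspace_def subalgebra_closed)
  then show "torus.span basis \<subseteq> cluster_algebra"
    by (intro torus.span_minimal basis_subset_cluster_algebra)
  have "torus.span (range standard_mon) \<subseteq> torus.span basis"
    by (intro torus.span_minimal torus.subspace_span) (auto simp: standard_mon_in_span_basis)
  then show "cluster_algebra \<subseteq> torus.span basis"
    using cluster_algebra_subset_span_standard by blast
qed

section \<open>Degrees\<close>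

definition deg :: "int \<times> int \<Rightarrow> torus \<Rightarrow> int" where
  "deg g x = Max (wt g ` supp x)"

definition deg_le :: "int \<times> int \<Rightarrow> torus \<Rightarrow> int \<Rightarrow> bool" where
  "deg_le g x n \<longleftrightarrow> (\<forall>e\<in>supp x. wt g e \<le> n)"

lemma deg_eqI:
  assumes "e \<in> supp x" "wt g e = n" "\<And>e. e \<in> supp x \<Longrightarrow> wt g e \<le> n"
  shows "deg g x = n"
  unfolding deg_def using assms by (intro Max_eqI) auto

lemma deg_le_deg: "deg_le g x (deg g x)"
  by (simp add: deg_le_def deg_def)

lemma deg_leD: "deg_le g x n \<Longrightarrow> n < wt g e \<Longrightarrow> coeff x e = 0"
  by (force simp: deg_le_def in_supp_iff)

lemma deg_le_mono: "deg_le g x m \<Longrightarrow> m \<le> n \<Longrightarrow> deg_le g x n"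
  by (force simp: deg_le_def)

lemma deg_le_add: "deg_le g x n \<Longrightarrow> deg_le g y n \<Longrightarrow> deg_le g (x + y) n"
  and deg_le_diff: "deg_le g x n \<Longrightarrow> deg_le g y n \<Longrightarrow> deg_le g (x - y) n"
  and deg_le_scale: "deg_le g x n \<Longrightarrow> deg_le g (c \<cdot> x) n"
  using supp_add supp_diff supp_scale by (fastforce simp: deg_le_def)+

lemma deg_le_mult: "deg_le g x m \<Longrightarrow> deg_le g y n \<Longrightarrow> deg_le g (x * y) (m + n)"
  unfolding deg_le_def by (metis add_mono supp_multE wt_add)

lemma deg_le_Xmon: "deg_le g (Xmon e) n \<longleftrightarrow> wt g e \<le> n"
  by (simp add: deg_le_def)

lemma deg_le_one: "deg_le g 1 0"
  by (simp add: deg_le_Xmon flip: Xmon_zero)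

lemma deg_le_power: "deg_le g x n \<Longrightarrow> deg_le g (x ^ k) (int k * n)"
proof (induction k)
  case (Suc k)
  then show ?case using deg_le_mult[of g x n "x ^ k" "int k * n"] by (simp add: algebra_simps)
qed (simp add: deg_le_one)

lemma deg_Xmon: "deg g (Xmon e) = wt g e"
  by (simp add: deg_def)

lemma deg_one: "deg g 1 = 0"
  by (simp add: deg_Xmon flip: Xmon_zero)

lemma deg_scale_tq: "deg g (tq i \<cdot> x) = deg g x"
  by (simp add: deg_def)

lemma leading_exp_deg: "leading_exp g x e \<Longrightarrow> wt g e = deg g x"
  by (rule deg_eqI[symmetric]) (auto simp: leading_exp_def)

lemma deg_mult:
  assumes "x \<noteq> 0" "y \<noteq> 0"
  shows "deg g (x * y) = deg g x + deg g y"
proof -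
  obtain e f where leading: "leading_exp g x e" "leading_exp g y f"
    using assms leading_exp_exists by metis
  show ?thesis
  proof (rule deg_eqI)
    show "e + f \<in> supp (x * y)" using leading by (rule leading_exp_mult_in_supp)
    show "wt g (e + f) = deg g x + deg g y" using leading by (simp add: wt_add leading_exp_deg)
    show "wt g h \<le> deg g x + deg g y" if "h \<in> supp (x * y)" for h
      using that deg_le_mult[OF deg_le_deg deg_le_deg] by (simp add: deg_le_def)
  qed
qed

lemma deg_power: "x \<noteq> 0 \<Longrightarrow> deg g (x ^ n) = int n * deg g x"
  by (induction n) (simp_all add: deg_one deg_mult algebra_simps)

lemma deg_add:
  assumes "x \<noteq> 0" "y \<noteq> 0" "deg g x \<noteq> deg g y"
  shows "deg g (x + y) = max (deg g x) (deg g y)"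
proof -
  have larger: "deg g (x + y) = deg g x" if "x \<noteq> 0" and less: "deg g y < deg g x" for x y
  proof -
    obtain e where leading_e: "leading_exp g x e" by (rule leading_exp_exists[OF \<open>x \<noteq> 0\<close>])
    then have "coeff y e = 0"
      using less deg_leD[OF deg_le_deg] leading_exp_deg by metis
    show ?thesis
    proof (rule deg_eqI)
      show "e \<in> supp (x + y)" using leading_e \<open>coeff y e = 0\<close> by (simp add: leading_exp_def in_supp_iff)
      show "wt g e = deg g x" using leading_e by (rule leading_exp_deg)
      have "deg_le g (x + y) (deg g x)"
        using less by (intro deg_le_add deg_le_deg deg_le_mono[OF deg_le_deg]) auto
      then show "wt g f \<le> deg g x" if "f \<in> supp (x + y)" for f
        using that by (simp add: deg_le_def)
    qed
  qed
  show ?thesis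
    using larger[of x y] larger[of y x] assms by (auto simp: max_def add.commute)
qed

theorem tropical_exchange:
  assumes "\<bar>s\<bar> = 1" "deg g (Xvar k) \<noteq> 0"
  shows "deg g (Xvar (k - s)) + deg g (Xvar (k + s)) = max (int (exch_exp k) * deg g (Xvar k)) 0"
proof -
  define y where "y = tq (s * int (exch_exp k)) \<cdot> Xvar k ^ exch_exp k"
  have "y \<noteq> 0" "deg g y = int (exch_exp k) * deg g (Xvar k)"
    by (simp_all add: y_def deg_scale_tq deg_power)
  then have "deg g (y + 1) = max (int (exch_exp k) * deg g (Xvar k)) 0"
    using assms(2) by (subst deg_add) (auto simp: deg_one exch_exp_def)
  also have "y + 1 = Xvar (k - s) * Xvar (k + s)"
    by (simp add: y_def Xvar_exchange[OF assms(1)])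
  finally show ?thesis by (simp add: deg_mult)
qed

lemma exch_exp_parity_wt:
  "\<bar>s\<bar> = 1 \<Longrightarrow> int (exch_exp k) * parity_wt k = 2 * parity_wt (k + s)"
  by (auto simp: exch_exp_def parity_wt_def abs_if split: if_splits)

text \<open>As long as the degrees are positive, the tropical exchange relations are linear, with
  solutions \<open>parity_wt k * u k\<close> for \<open>u\<close> affine; the bounds are those of the first two
  degrees after the sign change.\<close>

lemma deg_Xvar_descent:
  assumes abs_s: "\<bar>s\<bar> = 1"
    and "deg g (Xvar k) = parity_wt k * (2 * int n + 1)"
    and "deg g (Xvar (k + s)) = parity_wt (k + s) * (2 * int n - 1)"
  shows "deg_le g (Xvar (k + s * (int n + 1))) (-1) \<and> deg_le g (Xvar (k + s * (int n + 2))) (-1)"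
  using assms(2-3)
proof (induction n arbitrary: k)
  case 0
  then have degs: "deg g (Xvar k) = parity_wt k" "deg g (Xvar (k + s)) = - parity_wt (k + s)"
    by simp_all
  then have "int (exch_exp (k + s)) * deg g (Xvar (k + s)) \<le> 0"
    using parity_wt_pos[of "k + s"] by (intro mult_nonneg_nonpos) linarith+
  then have "deg g (Xvar k) + deg g (Xvar (k + s + s)) = 0"
    using tropical_exchange[OF abs_s, of g "k + s"] degs by simp
  then have "deg g (Xvar (k + s)) \<le> -1" "deg g (Xvar (k + s + s)) \<le> -1"
    using degs parity_wt_pos[of k] parity_wt_pos[of "k + s"] by linarith+
  then show ?case using deg_le_mono[OF deg_le_deg] by (simp add: algebra_simps)
next
  case (Suc n)
  have degs: "deg g (Xvar (k + s)) = parity_wt (k + s) * (2 * int n + 1)"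
    using Suc.prems(2) by simp
  then have pos: "deg g (Xvar (k + s)) > 0" by simp
  have periodic: "parity_wt (k + s + s) = parity_wt k"
    by (simp add: parity_wt_def)
  have weights: "int (exch_exp (k + s)) * parity_wt (k + s) = 2 * parity_wt k"
    using exch_exp_parity_wt[of "- s" "k + s"] abs_s by simp
  have "deg g (Xvar k) + deg g (Xvar (k + s + s)) = int (exch_exp (k + s)) * deg g (Xvar (k + s))"
    using tropical_exchange[OF abs_s, of g "k + s"] pos by simp
  also have "\<dots> = 2 * parity_wt k * (2 * int n + 1)"
    unfolding degs mult.assoc[symmetric] weights ..
  finally have "deg g (Xvar (k + s + s)) = parity_wt (k + s + s) * (2 * int n - 1)"
    unfolding Suc.prems(1) periodic by (simp add: algebra_simps)
  with degs show ?case using Suc.IH[of "k + s"] by (simp add: algebra_simps)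
qed

lemma deg_le_Xvar_right:
  assumes "m \<ge> 3"
  obtains g where "fst g > 0" "snd g > 0" "deg_le g (Xvar m) (-1)" "deg_le g (Xvar (m + 1)) (-1)"
proof -
  define n where "n = nat (m - 2)"
  define g where "g = (2 * (2 * int n + 1), 2 * int n - 1)"
  have n_eqs: "n \<ge> 1" "1 + 1 * (int n + 1) = m" "1 + 1 * (int n + 2) = m + 1"
    using assms by (simp_all add: n_def)
  have "deg_le g (Xvar m) (-1) \<and> deg_le g (Xvar (m + 1)) (-1)"
    using deg_Xvar_descent[of 1 g 1 n] unfolding n_eqs(2,3)
    by (simp add: Xvar_1 Xvar_2 deg_Xmon wt_def g_def parity_wt_def)
  then show ?thesis using that[of g] n_eqs(1) by (simp add: g_def)
qed

lemma deg_le_Xvar_left: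
  assumes "m \<le> -1"
  obtains g where "fst g > 0" "2 * snd g > fst g"
    "deg_le g (Xvar m) (-1)" "deg_le g (Xvar (m + 1)) (-1)"
proof -
  define n where "n = nat (- m)"
  define g where "g = (2 * (2 * int n - 1), 2 * int n + 1)"
  have n_eqs: "n \<ge> 1" "2 + -1 * (int n + 1) = m + 1" "2 + -1 * (int n + 2) = m"
    using assms by (simp_all add: n_def)
  have "deg_le g (Xvar m) (-1) \<and> deg_le g (Xvar (m + 1)) (-1)"
    using deg_Xvar_descent[of "-1" g 2 n] unfolding n_eqs(2,3)
    by (simp add: Xvar_1 Xvar_2 deg_Xmon wt_def g_def parity_wt_def)
  then show ?thesis using that[of g] n_eqs(1) by (simp add: g_def)
qed

lemma deg_le_Xvar_far:
  assumes "m \<ge> 3 \<or> m \<le> -1"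
  obtains g where "0 < fst g" "0 < snd g" "deg_le g (Xvar m) (-1)" "deg_le g (Xvar (m + 1)) (-1)"
  using assms
proof
  assume "m \<ge> 3"
  then show ?thesis by (rule deg_le_Xvar_right) (rule that)
next
  assume "m \<le> -1"
  then show ?thesis
  proof (rule deg_le_Xvar_left)
    fix g :: "int \<times> int"
    assume "fst g > 0" "2 * snd g > fst g" "deg_le g (Xvar m) (-1)" "deg_le g (Xvar (m + 1)) (-1)"
    then show ?thesis by (intro that[of g]) auto
  qed
qed

lemma deg_le_cluster_mon:
  assumes "deg_le g (Xvar m) r" "deg_le g (Xvar (m + 1)) s"
  shows "deg_le g (cluster_mon m a b) (int a * r + int b * s)"
  unfolding cluster_mon_def normal_mon_def
  using assms by (intro deg_le_scale deg_le_mult deg_le_power)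

lemma Xmon_power: "Xmon e ^ n = Xmon (scale_pt n e)"
  by (induction n) (simp_all add: Xmon_zero scale_pt_Suc Xmon_mult lam_scale_pt)

lemma cluster_mon_1: "cluster_mon 1 a b = Xmon (int a, int b)"
  by (simp add: cluster_mon_def normal_mon_def Xvar_1 Xvar_2 Xmon_power scale_pt_def Xmon_mult lam_def
      flip: tq_add)

lemma cluster_mon_0_right: "cluster_mon m a 0 = Xvar m ^ a"
  and cluster_mon_0_left: "cluster_mon m 0 b = Xvar (m + 1) ^ b"
  by (simp_all add: cluster_mon_def normal_mon_def)

lemma cluster_mon_initial_or_negative:
  obtains (initial) e where "cluster_mon m a b = Xmon e"
    | (negative) g where "0 \<le> fst g" "0 \<le> snd g" "deg_le g (cluster_mon m a b) (-1)"
proof -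
  consider (one) "a = 0" "b = 0" | (cluster_1) "m = 1" | (power_X2) "m = 2" "b = 0" | (power_X1) "m = 0" "a = 0"
    | (cluster_2) "m = 2" "b > 0" | (cluster_0) "m = 0" "a > 0"
    | (far) "m \<ge> 3 \<or> m \<le> -1" "a + b > 0" by arith
  then show ?thesis
  proof cases
    case one
    then show ?thesis using initial[of 0] by (simp add: cluster_mon_0_right Xmon_zero)
  next
    case cluster_1
    then show ?thesis using initial cluster_mon_1 by blast
  next
    case power_X2
    then show ?thesis using initial by (simp add: cluster_mon_0_right Xvar_2 Xmon_power)
  next
    case power_X1
    then show ?thesis using initial by (simp add: cluster_mon_0_left Xvar_1 Xmon_power)
  next
    case cluster_2
    have "deg_le (1, 0) (Xvar 2) 0" "deg_le (1, 0) (Xvar 3) (-1)"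
      by (simp_all add: Xvar_2 Xvar_3 deg_le_Xmon deg_le_add wt_def)
    then have "deg_le (1, 0) (cluster_mon 2 a b) (int a * 0 + int b * -1)"
      by (intro deg_le_cluster_mon) simp_all
    then show ?thesis using cluster_2 by (intro negative[of "(1, 0)"]) (auto elim: deg_le_mono)
  next
    case cluster_0
    have "deg_le (0, 1) (Xvar 0) (-1)" "deg_le (0, 1) (Xvar 1) 0"
      by (simp_all add: Xvar_0 Xvar_1 deg_le_Xmon deg_le_add wt_def)
    then have "deg_le (0, 1) (cluster_mon 0 a b) (int a * -1 + int b * 0)"
      by (intro deg_le_cluster_mon) simp_all
    then show ?thesis using cluster_0 by (intro negative[of "(0, 1)"]) (auto elim: deg_le_mono)
  next
    case far
    then obtain g where weights: "0 < fst g" "0 < snd g"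
      and negative_deg: "deg_le g (Xvar m) (-1)" "deg_le g (Xvar (m + 1)) (-1)"
      using deg_le_Xvar_far by metis
    have "deg_le g (cluster_mon m a b) (int a * -1 + int b * -1)"
      using negative_deg by (rule deg_le_cluster_mon)
    then show ?thesis using far(2) weights by (intro negative[of g]) (auto elim: deg_le_mono)
  qed
qed

lemma coeff_cluster_mon_quadrant:
  assumes "0 \<le> i" "0 \<le> j" "cluster_mon m a b \<noteq> Xmon (i, j)"
  shows "coeff (cluster_mon m a b) (i, j) = 0"
proof (cases m a b rule: cluster_mon_initial_or_negative)
  case initial
  with assms(3) show ?thesis by (auto simp: coeff_Xmon)
next
  case (negative g)
  have "0 \<le> wt g (i, j)" using negative(1,2) assms(1,2) by (simp add: wt_def)
  then show ?thesis by (intro deg_leD[OF negative(3)]) simp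
qed

lemma coeff_cluster_mon_ray:
  assumes "m \<le> -1" "n \<ge> 1"
  shows "coeff (cluster_mon m a b) (- int n, 2 * int n) = 0"
proof -
  obtain g where negative_deg: "fst g > 0" "2 * snd g > fst g" "deg_le g (Xvar m) (-1)" "deg_le g (Xvar (m + 1)) (-1)"
    using assms(1) by (rule deg_le_Xvar_left)
  have "wt g (- int n, 2 * int n) = int n * (2 * snd g - fst g)"
    by (simp add: wt_def algebra_simps)
  also have "\<dots> > 0" using negative_deg assms(2) by simp
  finally show ?thesis
    by (intro deg_leD[OF deg_le_cluster_mon[OF negative_deg(3,4)]]) linarith
qed

lemma chebyshev_add_inverse:
  assumes inverse: "z * w = 1" "w * z = 1" and "n \<ge> 1"
  shows "chebyshev n (z + w) = z ^ n + w ^ n"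
  using assms(3)
proof (induction n "z + w" rule: chebyshev.induct)
  case 3
  then show ?case by (simp add: distrib_left distrib_right inverse power2_eq_square numeral_2_eq_2)
next
  case (4 n)
  have "z ^ Suc (Suc n) * w = z ^ Suc n" "w ^ Suc (Suc n) * z = w ^ Suc n"
    using inverse by (simp_all add: power_Suc2 mult.assoc del: power_Suc)
  then have "(z ^ Suc (Suc n) + w ^ Suc (Suc n)) * (z + w) =
      z ^ Suc (Suc (Suc n)) + w ^ Suc (Suc (Suc n)) + (z ^ Suc n + w ^ Suc n)"
    by (simp add: distrib_left distrib_right power_Suc2 del: power_Suc)
  then show ?case using 4 by simp
qed simp_all

lemma deg_le_chebyshev: "deg_le g x 0 \<Longrightarrow> deg_le g (chebyshev n x) 0"
proof (induction n x rule: chebyshev.induct)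
  case (3 x)
  then have "deg_le g (x * x - (1 + 1)) 0"
    using deg_le_mult[of g x 0 x 0] by (intro deg_le_diff deg_le_add deg_le_one) simp_all
  then show ?case by simp
next
  case (4 n x)
  then show ?case
    using deg_le_mult[of g "chebyshev (Suc (Suc n)) x" 0 x 0] by (simp add: deg_le_diff)
qed (simp_all add: deg_le_one)

lemma deg_le_chebyshev_diff:
  assumes "deg_le g x 0" "deg_le g y 0" "deg_le g (x - y) r"
  shows "deg_le g (chebyshev n x - chebyshev n y) r"
  using assms
proof (induction n x rule: chebyshev.induct)
  case (1 x)
  then show ?case by (simp add: deg_le_def)
next
  case (3 x)
  have "chebyshev 2 x - chebyshev 2 y = x * (x - y) + (x - y) * y"
    by (simp add: algebra_simps numeral_2_eq_2)
  also have "deg_le g \<dots> r"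
    using deg_le_mult[OF 3(1,3)] deg_le_mult[OF 3(3,2)] by (intro deg_le_add) simp_all
  finally show ?case by (simp add: numeral_2_eq_2)
next
  case (4 n x)
  define u v where "u = chebyshev (Suc (Suc n)) x" and "v = chebyshev (Suc (Suc n)) y"
  have "chebyshev (Suc (Suc (Suc n))) x - chebyshev (Suc (Suc (Suc n))) y =
      u * (x - y) + (u - v) * y - (chebyshev (Suc n) x - chebyshev (Suc n) y)"
    by (simp add: u_def v_def algebra_simps)
  also have "deg_le g \<dots> r"
  proof (rule deg_le_diff[OF deg_le_add])
    show "deg_le g (u * (x - y)) r"
      using deg_le_mult[OF deg_le_chebyshev[OF 4(3)] 4(5)] by (simp add: u_def)
    show "deg_le g ((u - v) * y) r"
      using deg_le_mult[OF 4(1)[OF 4(3-5)] 4(4)] by (simp add: u_def v_def)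
    show "deg_le g (chebyshev (Suc n) x - chebyshev (Suc n) y) r" by (rule 4(2)[OF 4(3-5)])
  qed
  finally show ?case .
qed simp

text \<open>The Chebyshev polynomials of the first kind are those which leave no constant term here.\<close>

lemma coeff_chebyshev_X_delta:
  assumes "n \<ge> 1" "wt (2, 1) e \<ge> 0"
  shows "coeff (chebyshev n X_delta) e =
    (if e = (int n, - 2 * int n) \<or> e = (- int n, 2 * int n) then 1 else 0)"
proof -
  define z w where "z = Xmon (1, -2)" and "w = Xmon (-1, 2)"
  have inverse: "z * w = 1" "w * z = 1"
    by (simp_all add: z_def w_def Xmon_mult lam_def Xmon_zero flip: zero_prod_def)
  have "X_delta - (z + w) = Xmon (-1, -2) + (tq (-1) + tq 1) \<cdot> Xmon (0, -2)"
    by (simp add: X_delta_eq z_def w_def)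
  also have "deg_le (2, 1) \<dots> (-1)"
    by (intro deg_le_add deg_le_scale) (simp_all add: deg_le_Xmon wt_def)
  finally have lower: "deg_le (2, 1) (X_delta - (z + w)) (-1)" .
  have top: "deg_le (2, 1) (z + w) 0"
    by (intro deg_le_add) (simp_all add: z_def w_def deg_le_Xmon wt_def)
  have "deg_le (2, 1) X_delta 0"
    using deg_le_add[OF deg_le_mono[OF lower, of 0] top] by simp
  then have "deg_le (2, 1) (chebyshev n X_delta - chebyshev n (z + w)) (-1)"
    using top lower by (rule deg_le_chebyshev_diff)
  then have "coeff (chebyshev n X_delta - chebyshev n (z + w)) e = 0"
    using assms(2) by (elim deg_leD) simp
  then have "coeff (chebyshev n X_delta) e = coeff (z ^ n + w ^ n) e"
    by (simp add: chebyshev_add_inverse[OF inverse assms(1)])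
  then show ?thesis
    using assms(1) by (auto simp: z_def w_def Xmon_power scale_pt_def coeff_Xmon)
qed

lemma coeff_basis_quadrant:
  assumes "x \<in> basis" "0 \<le> i" "0 \<le> j" "x \<noteq> Xmon (i, j)"
  shows "coeff x (i, j) = 0"
  using assms(1)
proof (cases rule: basis_cases)
  case cluster
  then show ?thesis using assms by (simp add: coeff_cluster_mon_quadrant)
next
  case (cheb n)
  have "wt (2, 1) (i, j) \<ge> 0" using assms by (simp add: wt_def)
  with cheb show ?thesis using assms(2,3) by (simp add: coeff_chebyshev_X_delta)
qed

lemma coeff_chebyshev_X_delta_ray:
  assumes "n \<ge> 1" "n' \<ge> 1"
  shows "coeff (chebyshev n' X_delta) (- int n, 2 * int n) = (if n' = n then 1 else 0)"
  using assms by (subst coeff_chebyshev_X_delta) (auto simp: wt_def)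

section \<open>Expansions in the other clusters\<close>

definition diag :: "nat \<Rightarrow> torus" where
  "diag n = Xmon (int n, int n)"

lemma diag_add: "diag (m + n) = diag m * diag n"
  by (simp add: diag_def Xmon_mult lam_def)

lemma diag_0: "diag 0 = 1"
  by (simp add: diag_def Xmon_zero flip: zero_prod_def)

lemma supp_above_diag: "supp_above (int n, int n) (diag n)"
  and polynomial_diag [simp]: "supp_above 0 (diag n)"
  by (simp_all add: diag_def pt_le_def)

lemma diag_conjugate:
  assumes "supp_above 0 P"
  obtains P' where "supp_above 0 P'" "P * diag n = diag n * P'"
proof -
  define D where "D = Xmon (- int n, - int n)"
  have "D * diag n = 1" "diag n * D = 1"
    by (simp_all add: D_def diag_def Xmon_mult lam_def Xmon_zero flip: zero_prod_def)
  moreover have "supp_above (- int n, - int n) D"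
    by (simp add: D_def)
  then have "supp_above ((- int n, - int n) + 0 + (int n, int n)) (D * P * diag n)"
    using assms by (intro supp_above_mult supp_above_diag)
  ultimately show ?thesis
    using that[of "D * P * diag n"] by (simp add: zero_prod_def flip: mult.assoc)
qed

lemma supp_above_neg_exists: "\<exists>n. supp_above (- int n, - int n) Z"
proof -
  define n where "n = (\<Sum>e\<in>supp Z. nat \<bar>fst e\<bar> + nat \<bar>snd e\<bar>)"
  have "(- int n, - int n) \<preceq> e" if "e \<in> supp Z" for e
  proof -
    have "nat \<bar>fst e\<bar> + nat \<bar>snd e\<bar> \<le> n"
      unfolding n_def using that by (intro member_le_sum) auto
    then show ?thesis unfolding pt_le_def fst_conv snd_conv by linarith
  qed
  then show ?thesis unfolding supp_above_def by blast
qed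

lemma polynomial_mult_diag:
  assumes "supp_above (- int n, - int n) Z"
  shows "supp_above 0 (Z * diag n)"
  using supp_above_mult[OF assms supp_above_diag, of n] by (simp add: zero_prod_def)

definition bar :: "lpoly \<Rightarrow> lpoly" where
  "bar p = Poly_Mapping.map_key uminus p"

lemma inj_uminus_int: "inj (uminus :: int \<Rightarrow> int)"
  by (simp add: inj_def)

lemma bar_single: "bar (Poly_Mapping.single i a) = Poly_Mapping.single (- i) a"
  using map_key_single[OF inj_uminus_int, of "- i" a] by (simp add: bar_def)

lemma bar_add: "bar (p + q) = bar p + bar q"
  by (simp add: bar_def map_key_plus inj_uminus_int)

lemma bar_mult: "bar (p * q) = bar p * bar q"
proof (induction p rule: poly_mapping_plus_induct)
  case (single a b)
  show ?case
    by (induction q rule: poly_mapping_plus_induct)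
       (simp_all add: mult_single bar_single bar_add distrib_left)
qed (simp add: bar_add distrib_right)

lemma bar_bar: "bar (bar p) = p"
  by (induction p rule: poly_mapping_plus_induct) (simp_all add: bar_single bar_add)

lemma lpoly_nonneg_bar: "lpoly_nonneg p \<Longrightarrow> lpoly_nonneg (bar p)"
  by (simp add: lpoly_nonneg_def bar_def map_key.rep_eq inj_uminus_int)

text \<open>The substitution \<open>X_k \<mapsto> X_(c + s k)\<close> is a shift for \<open>s = 1\<close> and a reflection for
  \<open>s = - 1\<close>; the latter is multiplicative only when combined with the bar involution of the coefficients.\<close>

locale cluster_symmetry =
  fixes c s :: int
  assumes even_c: "even c" and abs_s: "\<bar>s\<bar> = 1"
begin

lemma sign_cases: "s = 1 \<or> s = -1"
  using abs_s by linarith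

definition xs :: "int \<Rightarrow> torus" where
  "xs k = Xvar (c + s * k)"

definition tau :: "lpoly \<Rightarrow> lpoly" where
  "tau p = (if s = 1 then p else bar p)"

lemma tau_add: "tau (p + q) = tau p + tau q"
  and tau_mult: "tau (p * q) = tau p * tau q"
  and tau_tau [simp]: "tau (tau p) = p"
  and lpoly_nonneg_tau: "lpoly_nonneg p \<Longrightarrow> lpoly_nonneg (tau p)"
  by (simp_all add: tau_def bar_add bar_mult bar_bar lpoly_nonneg_bar)

lemma tau_tq: "tau (tq i) = tq (s * i)"
  using sign_cases by (auto simp: tau_def tq_def bar_single)

lemma tau_0 [simp]: "tau 0 = 0"
  using tau_add[of 0 0] by simp

lemma tau_1 [simp]: "tau 1 = 1"
  using tau_tq[of 0] by simp

lemma tau_minus: "tau (- p) = - tau p"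
  using tau_add[of p "- p"] by (simp add: eq_neg_iff_add_eq_0 add.commute)

lemma tau_eq_0_iff [simp]: "tau p = 0 \<longleftrightarrow> p = 0"
  by (metis tau_0 tau_tau)

lemma xs_nonzero [simp]: "xs k \<noteq> 0"
  by (simp add: xs_def)

lemma xs_qcommute: "xs k * xs (k + 1) = tq (2 * s) \<cdot> (xs (k + 1) * xs k)"
  using Xvar_qcommute[OF abs_s, of "c + s * k"] by (simp add: xs_def algebra_simps)

lemma xs_exchange:
  assumes "\<bar>d\<bar> = 1"
  shows "xs (k - d) * xs (k + d) = tq (s * (d * int (exch_exp k))) \<cdot> xs k ^ exch_exp k + 1"
proof -
  have "exch_exp (c + s * k) = exch_exp k"
    using even_c sign_cases by (auto simp: exch_exp_def)
  moreover have "\<bar>s * d\<bar> = 1" using abs_s assms by (simp add: abs_mult)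
  ultimately show ?thesis
    using Xvar_exchange[of "s * d" "c + s * k"] by (simp add: xs_def algebra_simps)
qed

lemma X_delta_eq_xs: "X_delta = tq s \<cdot> (xs 0 * xs 4) - tq (3 * s) \<cdot> (xs 2 * xs 2)"
proof -
  obtain i where c_eq: "c = 2 * i" using even_c by (elim evenE)
  define j where "j = i + s"
  have "c + s * 0 = 2 * (j - s)" "c + s * 4 = 2 * (j + s)" "c + s * 2 = 2 * j"
    by (simp_all add: c_eq j_def)
  then show ?thesis
    unfolding xs_def using X_delta_eq_Xeven[OF abs_s, of j] by (simp only: Xvar_even)
qed

definition sigma_mon :: "int \<times> int \<Rightarrow> torus" where
  "sigma_mon e = normal_mon s (xs 1) (xs 2) (nat (fst e)) (nat (snd e))"

definition sigma :: "torus \<Rightarrow> torus" where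
  "sigma P = (\<Sum>e\<in>supp P. tau (coeff P e) \<cdot> sigma_mon e)"

lemma sigma_mon_mult:
  assumes "0 \<preceq> e" "0 \<preceq> f"
  shows "sigma_mon e * sigma_mon f = tq (s * lam e f) \<cdot> sigma_mon (e + f)"
  using normal_mon_mult[of "xs 1" "xs 2" s "nat (fst e)" "nat (snd e)" "nat (fst f)" "nat (snd f)"]
    xs_qcommute[of 1] assms
  by (simp add: sigma_mon_def pt_le_def nat_add_distrib lam_def)

lemma sigma_superset: "finite A \<Longrightarrow> supp P \<subseteq> A \<Longrightarrow> sigma P = (\<Sum>e\<in>A. tau (coeff P e) \<cdot> sigma_mon e)"
  unfolding sigma_def by (rule sum.mono_neutral_left) (auto simp: in_supp_iff)

lemma sigma_add: "sigma (P + Q) = sigma P + sigma Q"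
  using supp_add[of P Q]
  by (simp add: sigma_superset[of "supp P \<union> supp Q"] tau_add scale_add_left sum.distrib)

lemma sigma_scale: "sigma (p \<cdot> P) = tau p \<cdot> sigma P"
  using supp_scale[of p P]
  by (simp add: sigma_superset[of "supp P"] tau_mult scale_sum_right)

lemma sigma_0 [simp]: "sigma 0 = 0"
  using sigma_add[of 0 0] by simp

lemma sigma_sum: "sigma (\<Sum>a\<in>A. f a) = (\<Sum>a\<in>A. sigma (f a))"
  by (induction A rule: infinite_finite_induct) (simp_all add: sigma_add)

lemma sigma_Xmon: "sigma (Xmon e) = sigma_mon e"
  by (simp add: sigma_def coeff_Xmon)

lemma sigma_mult:
  assumes "supp_above 0 P" "supp_above 0 Q"
  shows "sigma (P * Q) = sigma P * sigma Q"
proof -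
  have "P * Q = (\<Sum>e\<in>supp P. coeff P e \<cdot> Xmon e) * (\<Sum>f\<in>supp Q. coeff Q f \<cdot> Xmon f)"
    using eq_sum_Xmon[of P] eq_sum_Xmon[of Q] by simp
  also have "\<dots> = (\<Sum>e\<in>supp P. \<Sum>f\<in>supp Q. (coeff P e * coeff Q f * tq (lam e f)) \<cdot> Xmon (e + f))"
    by (simp add: sum_product Xmon_mult ac_simps)
  finally have "sigma (P * Q) = (\<Sum>e\<in>supp P. \<Sum>f\<in>supp Q.
      (tau (coeff P e) * tau (coeff Q f)) \<cdot> tq (s * lam e f) \<cdot> sigma_mon (e + f))"
    by (simp add: sigma_sum sigma_scale sigma_Xmon tau_mult tau_tq)
  also have "\<dots> = (\<Sum>e\<in>supp P. \<Sum>f\<in>supp Q. (tau (coeff P e) * tau (coeff Q f)) \<cdot> (sigma_mon e * sigma_mon f))"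
    using assms by (intro sum.cong refl) (simp add: sigma_mon_mult supp_above_def del: scale_scale)
  also have "\<dots> = sigma P * sigma Q"
    by (simp add: sigma_def sum_product mult.commute)
  finally show ?thesis .
qed

lemma sigma_diag_nonzero [simp]: "sigma (diag n) \<noteq> 0"
  by (simp add: diag_def sigma_Xmon sigma_mon_def normal_mon_def)

lemma sigma_eq_0:
  assumes polynomial_P: "supp_above 0 P" and "sigma P = 0"
  shows "P = 0"
proof (rule ccontr)
  assume "P \<noteq> 0"
  then obtain e where e_in_supp: "e \<in> supp P" using supp_eq_empty_iff by blast
  define p r where "p = Xvar_pt (c + s * 1)" and "r = Xvar_pt (c + s * 2)"
  define pt where "pt e = scale_pt (nat (fst e)) p + scale_pt (nat (snd e)) r" for e
  have "lam p r \<noteq> 0"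
    using lam_Xvar_pt[OF abs_s, of "c + s * 1"] abs_s by (auto simp: p_def r_def algebra_simps)
  have inj_pt: "inj_on pt (supp P)"
  proof (rule inj_onI)
    fix e f assume supp: "e \<in> supp P" "f \<in> supp P" and "pt e = pt f"
    then have "nat (fst e) = nat (fst f) \<and> nat (snd e) = nat (snd f)"
      unfolding pt_def by (intro scale_pt_combination_inject[OF \<open>lam p r \<noteq> 0\<close>])
    moreover have "0 \<preceq> e" "0 \<preceq> f" using polynomial_P supp by (simp_all add: supp_above_def)
    ultimately show "e = f" by (simp add: pt_le_def prod_eq_iff eq_nat_nat_iff)
  qed
  have pointed_sigma_mon: "pointed (pt e) (sigma_mon e)" for e
    unfolding pt_def p_def r_def sigma_mon_def xs_def by (intro pointed_normal_mon pointed_Xvar)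
  obtain f where "pt f \<in> supp (sigma P)"
  proof (rule pointed_sum_in_supp[of "supp P" pt sigma_mon e "\<lambda>e. tau (coeff P e)"])
  qed (use inj_pt pointed_sigma_mon e_in_supp in \<open>simp_all add: sigma_def in_supp_iff\<close>)
  then show False using assms(2) by (simp add: in_supp_iff)
qed

text \<open>\<open>expansion Z Y\<close> says that the Laurent polynomial \<open>Z\<close> turns into \<open>Y\<close> when \<open>xs 1\<close> and \<open>xs 2\<close>
  are substituted for \<open>X_1\<close> and \<open>X_2\<close>, with the denominators cleared.\<close>

definition expansion_upto :: "nat \<Rightarrow> torus \<Rightarrow> torus \<Rightarrow> bool" where
  "expansion_upto n Z Y \<longleftrightarrow> supp_above (- int n, - int n) Z \<and> Y * sigma (diag n) = sigma (Z * diag n)"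

definition expansion :: "torus \<Rightarrow> torus \<Rightarrow> bool" where
  "expansion Z Y \<longleftrightarrow> (\<exists>n. expansion_upto n Z Y)"

lemma expansion_upto_mono:
  assumes "expansion_upto m Z Y" "m \<le> n"
  shows "expansion_upto n Z Y"
proof -
  have supp_Z: "supp_above (- int m, - int m) Z" and Y_eq: "Y * sigma (diag m) = sigma (Z * diag m)"
    using assms(1) by (simp_all add: expansion_upto_def)
  have diag_n: "diag n = diag m * diag (n - m)" using assms(2) by (simp flip: diag_add)
  have "Y * sigma (diag n) = sigma (Z * diag m) * sigma (diag (n - m))"
    by (simp add: diag_n sigma_mult Y_eq flip: mult.assoc)
  also have "\<dots> = sigma (Z * diag n)"
    using supp_Z by (simp add: diag_n sigma_mult polynomial_mult_diag flip: mult.assoc)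
  finally show ?thesis
    using supp_Z assms(2) by (auto simp: expansion_upto_def pt_le_def elim: supp_above_mono)
qed

lemma expansion_common_denominator:
  assumes "expansion Z Y" "expansion Z' Y'"
  obtains n where "expansion_upto n Z Y" "expansion_upto n Z' Y'"
  using assms by (metis max.cobounded1 max.cobounded2 expansion_upto_mono expansion_def)

lemma expansion_add:
  assumes "expansion Z Y" "expansion Z' Y'"
  shows "expansion (Z + Z') (Y + Y')"
proof -
  obtain n where "expansion_upto n Z Y" "expansion_upto n Z' Y'"
    using assms by (rule expansion_common_denominator)
  then have "expansion_upto n (Z + Z') (Y + Y')"
    by (simp add: expansion_upto_def supp_above_add distrib_right sigma_add)
  then show ?thesis by (auto simp: expansion_def)
qed

lemma expansion_scale:
  assumes "expansion Z Y"
  shows "expansion (p \<cdot> Z) (tau p \<cdot> Y)"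
proof -
  obtain n where "expansion_upto n Z Y" using assms by (auto simp: expansion_def)
  then have "expansion_upto n (p \<cdot> Z) (tau p \<cdot> Y)"
    by (simp add: expansion_upto_def supp_above_scale sigma_scale)
  then show ?thesis by (auto simp: expansion_def)
qed

lemma expansion_diff: "expansion Z Y \<Longrightarrow> expansion Z' Y' \<Longrightarrow> expansion (Z - Z') (Y - Y')"
  using expansion_add[of Z Y "(-1) \<cdot> Z'" "(-1) \<cdot> Y'"] expansion_scale[of Z' Y' "-1"]
  by (simp add: scale_minus_left tau_minus)

lemma sigma_mult_diag_diag:
  assumes "supp_above (- int n, - int n) A" "supp_above (- int n, - int n) B"
    and sigma_A: "sigma (A * diag n) = A' * sigma (diag n)"
  shows "sigma (A * B * diag (n + n)) = A' * sigma (B * diag n) * sigma (diag n)"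
proof -
  obtain P where conjugate: "supp_above 0 P" "(B * diag n) * diag n = diag n * P"
    using diag_conjugate polynomial_mult_diag[OF assms(2)] by metis
  have "sigma (A * B * diag (n + n)) = sigma (A * ((B * diag n) * diag n))"
    by (simp add: diag_add mult.assoc)
  also have "\<dots> = sigma (A * diag n * P)"
    unfolding conjugate(2) by (simp add: mult.assoc)
  also have "\<dots> = sigma (A * diag n) * sigma P"
    using conjugate(1) assms(1) by (intro sigma_mult polynomial_mult_diag)
  also have "\<dots> = A' * (sigma (diag n) * sigma P)"
    by (simp add: sigma_A mult.assoc)
  also have "\<dots> = A' * sigma ((B * diag n) * diag n)"
    unfolding conjugate(2) using conjugate(1) by (simp add: sigma_mult)
  also have "\<dots> = A' * sigma (B * diag n) * sigma (diag n)"
    by (simp only: sigma_mult[OF polynomial_mult_diag[OF assms(2)] polynomial_diag])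
       (simp only: mult.assoc)
  finally show ?thesis .
qed

lemma expansion_mult:
  assumes "expansion Z Y" "expansion Z' Y'"
  shows "expansion (Z * Z') (Y * Y')"
proof -
  obtain n where "expansion_upto n Z Y" "expansion_upto n Z' Y'"
    using assms by (rule expansion_common_denominator)
  then have supp: "supp_above (- int n, - int n) Z" "supp_above (- int n, - int n) Z'"
    and sigma_eq: "sigma (Z * diag n) = Y * sigma (diag n)" "sigma (Z' * diag n) = Y' * sigma (diag n)"
    by (simp_all add: expansion_upto_def)
  have "Y * Y' * sigma (diag (n + n)) = sigma (Z * Z' * diag (n + n))"
    unfolding sigma_mult_diag_diag[OF supp sigma_eq(1)] sigma_eq(2) by (simp add: diag_add sigma_mult mult.assoc)
  moreover have "supp_above (- int (n + n), - int (n + n)) (Z * Z')"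
    using supp_above_mult[OF supp] by simp
  ultimately have "expansion_upto (n + n) (Z * Z') (Y * Y')"
    by (simp add: expansion_upto_def)
  then show ?thesis by (auto simp: expansion_def)
qed

lemma expansion_cancel_left:
  assumes "expansion A A'" "expansion (A * B) (A' * B')" "A' \<noteq> 0"
  shows "expansion B B'"
proof -
  obtain k where upto: "expansion_upto k A A'" "expansion_upto k (A * B) (A' * B')"
    using assms(1,2) by (rule expansion_common_denominator)
  obtain l where supp_B_l: "supp_above (- int l, - int l) B" using supp_above_neg_exists by blast
  define n where "n = max k l"
  have supp_B: "supp_above (- int n, - int n) B"
    using supp_B_l by (rule supp_above_mono) (simp add: n_def pt_le_def)
  have "expansion_upto n A A'" "expansion_upto (n + n) (A * B) (A' * B')"
    using upto by (auto simp: n_def elim: expansion_upto_mono)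
  then have A_cleared: "supp_above (- int n, - int n) A" "sigma (A * diag n) = A' * sigma (diag n)"
    and AB_cleared: "A' * B' * sigma (diag (n + n)) = sigma (A * B * diag (n + n))"
    by (simp_all add: expansion_upto_def)
  have "A' * (B' * sigma (diag n)) * sigma (diag n) = A' * sigma (B * diag n) * sigma (diag n)"
    using AB_cleared unfolding sigma_mult_diag_diag[OF A_cleared(1) supp_B A_cleared(2)]
    by (simp add: diag_add sigma_mult mult.assoc)
  then have "A' * (B' * sigma (diag n)) = A' * sigma (B * diag n)"
    by (simp only: mult_right_cancel[OF sigma_diag_nonzero])
  then have "B' * sigma (diag n) = sigma (B * diag n)"
    by (simp only: mult_left_cancel[OF assms(3)])
  then show ?thesis using supp_B by (auto simp: expansion_def expansion_upto_def)
qed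

lemma expansion_Xmon:
  assumes "0 \<preceq> e"
  shows "expansion (Xmon e) (sigma_mon e)"
proof -
  have "sigma 1 = 1"
    using sigma_Xmon[of 0] by (simp add: Xmon_zero sigma_mon_def normal_mon_def)
  then have "expansion_upto 0 (Xmon e) (sigma_mon e)"
    using assms by (simp add: expansion_upto_def diag_0 sigma_Xmon flip: zero_prod_def)
  then show ?thesis by (auto simp: expansion_def)
qed

lemma expansion_one: "expansion 1 1"
  using expansion_Xmon[of 0] by (simp add: Xmon_zero sigma_mon_def normal_mon_def)

lemma expansion_zero: "expansion 0 0"
  using expansion_scale[OF expansion_one, of 0] by simp

lemma expansion_power: "expansion Z Y \<Longrightarrow> expansion (Z ^ n) (Y ^ n)"
  by (induction n) (simp_all add: expansion_one expansion_mult)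

lemma expansion_sum: "(\<And>a. a \<in> A \<Longrightarrow> expansion (f a) (g a)) \<Longrightarrow> expansion (sum f A) (sum g A)"
  by (induction A rule: infinite_finite_induct) (simp_all add: expansion_zero expansion_add)

lemma expansion_chebyshev: "expansion Z Y \<Longrightarrow> expansion (chebyshev n Z) (chebyshev n Y)"
proof (induction n Z arbitrary: Y rule: chebyshev.induct)
  case (3 Z)
  then have "expansion (Z * Z - (1 + 1)) (Y * Y - (1 + 1))"
    by (intro expansion_diff expansion_mult expansion_add expansion_one)
  then show ?case by simp
qed (simp_all add: expansion_one expansion_diff expansion_mult)

lemma expansion_left_unique:
  assumes "expansion Z Y" "expansion Z' Y"
  shows "Z = Z'"
proof -
  have "expansion (Z - Z') 0" using expansion_diff[OF assms] by simp
  then obtain n where "supp_above (- int n, - int n) (Z - Z')" "sigma ((Z - Z') * diag n) = 0"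
    by (auto simp: expansion_def expansion_upto_def)
  then have "(Z - Z') * diag n = 0" using sigma_eq_0 polynomial_mult_diag by blast
  then show ?thesis by (simp add: diag_def)
qed

lemma expansion_right_unique:
  assumes "expansion Z Y" "expansion Z Y'"
  shows "Y = Y'"
proof -
  obtain n where "expansion_upto n Z Y" "expansion_upto n Z Y'"
    using assms by (rule expansion_common_denominator)
  then have "Y * sigma (diag n) = Y' * sigma (diag n)" by (simp add: expansion_upto_def)
  then show ?thesis by simp
qed

lemma expansion_Xvar: "expansion (Xvar k) (xs k)"
proof (induction k rule: int_bidirectional_induct[where k = 1])
  case base
  show ?case
    using expansion_Xmon[of "(1, 0)"] by (simp add: Xvar_1 sigma_mon_def normal_mon_def pt_le_def)
next
  case base_Suc
  show ?case
    using expansion_Xmon[of "(0, 1)"] by (simp add: Xvar_2 sigma_mon_def normal_mon_def pt_le_def)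
next
  case (step j d)
  have "expansion (tq (d * int (exch_exp j)) \<cdot> Xvar j ^ exch_exp j + 1)
      (tau (tq (d * int (exch_exp j))) \<cdot> xs j ^ exch_exp j + 1)"
    by (intro expansion_add expansion_scale expansion_power expansion_one step)
  then have "expansion (Xvar (j - d) * Xvar (j + d)) (xs (j - d) * xs (j + d))"
    by (simp add: Xvar_exchange[OF step(1)] xs_exchange[OF step(1)] tau_tq)
  then show ?case using expansion_cancel_left step(2) xs_nonzero by blast
qed

lemma expansion_X_delta: "expansion X_delta X_delta"
proof -
  have "X_delta = tq 1 \<cdot> (Xvar 0 * Xvar 4) - tq 3 \<cdot> (Xvar 2 * Xvar 2)"
    using X_delta_eq_Xeven[of 1 1] by (simp add: Xvar_def)
  moreover have "expansion (tq 1 \<cdot> (Xvar 0 * Xvar 4) - tq 3 \<cdot> (Xvar 2 * Xvar 2))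
      (tau (tq 1) \<cdot> (xs 0 * xs 4) - tau (tq 3) \<cdot> (xs 2 * xs 2))"
    by (intro expansion_diff expansion_scale expansion_mult expansion_Xvar)
  ultimately show ?thesis using X_delta_eq_xs by (simp add: tau_tq mult.commute)
qed

lemma expansion_cluster_mon:
  "s = 1 \<Longrightarrow> expansion (cluster_mon (m - c) a b) (cluster_mon m a b)"
  "s = -1 \<Longrightarrow> expansion (cluster_mon (c - m - 1) b a) (cluster_mon m a b)"
proof -
  have expansion_normal_mon: "expansion (cluster_mon k a b) (normal_mon s (xs k) (xs (k + 1)) a b)" for k a b
  proof -
    have "expansion (cluster_mon k a b) (tau (tq (- (1 * (int a * int b)))) \<cdot> (xs k ^ a * xs (k + 1) ^ b))"
      unfolding cluster_mon_def normal_mon_def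
      by (intro expansion_scale expansion_mult expansion_power expansion_Xvar)
    then show ?thesis by (simp add: tau_tq normal_mon_def)
  qed
  show "expansion (cluster_mon (m - c) a b) (cluster_mon m a b)" if "s = 1"
  proof -
    have "xs (m - c) = Xvar m" "xs (m - c + 1) = Xvar (m + 1)"
      unfolding xs_def by (simp_all add: that)
    then show ?thesis using expansion_normal_mon[of "m - c" a b] that by (simp add: cluster_mon_def)
  qed
  show "expansion (cluster_mon (c - m - 1) b a) (cluster_mon m a b)" if "s = -1"
  proof -
    have "xs (c - m - 1) = Xvar (m + 1)" "xs (c - m - 1 + 1) = Xvar m"
      unfolding xs_def by (simp_all add: that add.commute)
    then show ?thesis
      using expansion_normal_mon[of "c - m - 1" b a] normal_mon_swap[of "Xvar m" "Xvar (m + 1)" 1 a b] Xvar_qcommute[of 1 m] that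
      by (simp add: cluster_mon_def)
  qed
qed

lemma expansion_basis: "b \<in> basis \<Longrightarrow> \<exists>Z\<in>basis. expansion Z b"
  using sign_cases expansion_cluster_mon expansion_chebyshev[OF expansion_X_delta]
    cluster_mon_in_basis chebyshev_in_basis
  by (elim basis_cases) blast+

end

section \<open>Positivity\<close>

lemma lpoly_nonneg_add: "lpoly_nonneg p \<Longrightarrow> lpoly_nonneg q \<Longrightarrow> lpoly_nonneg (p + q)"
  by (simp add: lpoly_nonneg_def lookup_add)

lemma lpoly_nonneg_0: "lpoly_nonneg 0"
  and lpoly_nonneg_1: "lpoly_nonneg 1"
  and lpoly_nonneg_tq: "lpoly_nonneg (tq i)"
  by (simp_all add: lpoly_nonneg_def tq_def lookup_one lookup_single when_def)

lemma lpoly_nonneg_mult: "lpoly_nonneg p \<Longrightarrow> lpoly_nonneg q \<Longrightarrow> lpoly_nonneg (p * q)"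
  unfolding lpoly_nonneg_def lookup_mult Sum_any.expand_set
  by (auto intro!: sum_nonneg mult_nonneg_nonneg simp: when_def)

lemma lpoly_nonneg_mult_tq_iff: "lpoly_nonneg (p * tq i) \<longleftrightarrow> lpoly_nonneg p"
proof
  assume "lpoly_nonneg (p * tq i)"
  then have "lpoly_nonneg (p * tq i * tq (- i))" by (rule lpoly_nonneg_mult) (rule lpoly_nonneg_tq)
  then show "lpoly_nonneg p" by (simp add: mult.assoc flip: tq_add)
qed (simp add: lpoly_nonneg_mult lpoly_nonneg_tq)

definition nonneg_coeffs :: "torus \<Rightarrow> bool" where
  "nonneg_coeffs x \<longleftrightarrow> (\<forall>e. lpoly_nonneg (coeff x e))"

lemma nonneg_coeffs_sum: "(\<And>a. a \<in> A \<Longrightarrow> nonneg_coeffs (f a)) \<Longrightarrow> nonneg_coeffs (sum f A)"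
  by (induction A rule: infinite_finite_induct)
     (simp_all add: nonneg_coeffs_def lpoly_nonneg_0 lpoly_nonneg_add)

lemma nonneg_coeffs_scale: "lpoly_nonneg c \<Longrightarrow> nonneg_coeffs x \<Longrightarrow> nonneg_coeffs (c \<cdot> x)"
  by (simp add: nonneg_coeffs_def lpoly_nonneg_mult)

lemma nonneg_coeffs_one: "nonneg_coeffs 1"
  by (simp add: nonneg_coeffs_def coeff_one lpoly_nonneg_0 lpoly_nonneg_1)

lemma nonneg_coeffs_Xmon_mult_iff: "nonneg_coeffs (Xmon e * x) \<longleftrightarrow> nonneg_coeffs x"
proof -
  have "coeff (Xmon e * x) (e + f) = coeff x f * tq (lam e f)" for f
    using coeff_mult_unique[of "Xmon e" x e f] by (simp add: coeff_Xmon)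
  then have "lpoly_nonneg (coeff (Xmon e * x) (e + f)) \<longleftrightarrow> lpoly_nonneg (coeff x f)" for f
    by (simp only: lpoly_nonneg_mult_tq_iff)
  then show ?thesis
    unfolding nonneg_coeffs_def by (metis add_diff_cancel_left' add.commute diff_add_cancel)
qed

lemma nonneg_coeffs_mult_Xmon_iff: "nonneg_coeffs (x * Xmon e) \<longleftrightarrow> nonneg_coeffs x"
proof -
  have "coeff (x * Xmon e) (f + e) = coeff x f * tq (lam f e)" for f
    using coeff_mult_unique[of x "Xmon e" f e] by (simp add: coeff_Xmon)
  then have "lpoly_nonneg (coeff (x * Xmon e) (f + e)) \<longleftrightarrow> lpoly_nonneg (coeff x f)" for f
    by (simp only: lpoly_nonneg_mult_tq_iff)
  then show ?thesis
    unfolding nonneg_coeffs_def by (metis diff_add_cancel)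
qed

lemma nonneg_coeffs_Xmon_power_mult_power_iff:
  "nonneg_coeffs (Xmon u ^ a * x * Xmon v ^ b) \<longleftrightarrow> nonneg_coeffs x"
  by (simp add: Xmon_power nonneg_coeffs_Xmon_mult_iff nonneg_coeffs_mult_Xmon_iff)

lemma qtorus_of_sum: "qtorus_of (sum f A) = (\<Sum>a\<in>A. qtorus_of (f a))"
  by (induction A rule: infinite_finite_induct) (simp_all add: zero_torus.rep_eq plus_torus.rep_eq)

lemma laurent_exp_qtorus_ofE:
  assumes "laurent_exp m c (qtorus_of y)"
  obtains N where "Xvar m ^ N * y * Xvar (m + 1) ^ N =
     (\<Sum>e\<in>Poly_Mapping.keys c. Poly_Mapping.lookup c e \<cdot>
        (Xvar m ^ nat (fst e + int N) * Xvar (m + 1) ^ nat (snd e + int N)))"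
  using assms
  by (auto simp: laurent_exp_def Xc_eq qtorus_of_simps split_beta simp flip: qtorus_of_sum)

context cluster_symmetry
begin

lemma adjacent_pair:
  obtains m u v where "expansion (Xmon u) (Xvar m)" "expansion (Xmon v) (Xvar (m + 1))"
proof (cases "s = 1")
  case True
  then show ?thesis
    using that[of "(1, 0)" "c + 1" "(0, 1)"] expansion_Xvar[of 1] expansion_Xvar[of 2]
    unfolding xs_def Xvar_1 Xvar_2 by (simp add: add.assoc)
next
  case False
  then have "c + s * 2 = c - 2" "c + s * 1 = c - 2 + 1" using sign_cases by auto
  then show ?thesis
    using that[of "(0, 1)" "c - 2" "(1, 0)"] expansion_Xvar[of 1] expansion_Xvar[of 2]
    unfolding xs_def Xvar_1 Xvar_2 by simp
qed

lemma nonneg_coeffs_expansion: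
  assumes "positive (qtorus_of y)" "expansion Z y"
  shows "nonneg_coeffs Z"
proof -
  obtain m u v where cluster: "expansion (Xmon u) (Xvar m)" "expansion (Xmon v) (Xvar (m + 1))"
    by (rule adjacent_pair)
  obtain p where laurent: "laurent_exp m p (qtorus_of y)" "\<And>e. lpoly_nonneg (Poly_Mapping.lookup p e)"
    using assms(1) unfolding positive_def by blast
  define K where "K = Poly_Mapping.keys p"
  obtain N where cleared: "Xvar m ^ N * y * Xvar (m + 1) ^ N =
     (\<Sum>e\<in>K. Poly_Mapping.lookup p e \<cdot> (Xvar m ^ nat (fst e + int N) * Xvar (m + 1) ^ nat (snd e + int N)))"
    using laurent(1) unfolding K_def by (rule laurent_exp_qtorus_ofE)
  define W where "W = (\<Sum>e\<in>K. tau (Poly_Mapping.lookup p e) \<cdot>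
      (Xmon u ^ nat (fst e + int N) * 1 * Xmon v ^ nat (snd e + int N)))"
  have "expansion W (\<Sum>e\<in>K. tau (tau (Poly_Mapping.lookup p e)) \<cdot>
      (Xvar m ^ nat (fst e + int N) * 1 * Xvar (m + 1) ^ nat (snd e + int N)))"
    unfolding W_def by (intro expansion_sum expansion_scale expansion_mult expansion_power expansion_one cluster)
  then have "expansion W (Xvar m ^ N * y * Xvar (m + 1) ^ N)"
    by (simp add: cleared)
  moreover have "expansion (Xmon u ^ N * Z * Xmon v ^ N) (Xvar m ^ N * y * Xvar (m + 1) ^ N)"
    by (intro expansion_mult expansion_power cluster assms(2))
  ultimately have "Xmon u ^ N * Z * Xmon v ^ N = W"
    using expansion_left_unique by blast
  moreover have "nonneg_coeffs W"
    unfolding W_def using nonneg_coeffs_one laurent(2)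
    by (intro nonneg_coeffs_sum nonneg_coeffs_scale lpoly_nonneg_tau)
       (simp_all add: nonneg_coeffs_Xmon_power_mult_power_iff del: mult_1_right)
  ultimately show ?thesis by (simp flip: nonneg_coeffs_Xmon_power_mult_power_iff[of u N Z v N])
qed

definition isolates :: "int \<times> int \<Rightarrow> torus \<Rightarrow> torus set \<Rightarrow> bool" where
  "isolates e x S \<longleftrightarrow> (\<forall>y\<in>S. \<exists>Z. expansion Z y \<and> coeff Z e = (if y = x then 1 else 0))"

lemma isolates_coeff:
  assumes "isolates e x S" "finite S" "x \<in> S"
  obtains Z where "expansion Z (\<Sum>y\<in>S. u y \<cdot> y)" "coeff Z e = tau (u x)"
proof -
  obtain f where expansion_f: "\<And>y. y \<in> S \<Longrightarrow> expansion (f y) y \<and> coeff (f y) e = (if y = x then 1 else 0)"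
    using assms(1) unfolding isolates_def by metis
  define Z where "Z = (\<Sum>y\<in>S. tau (u y) \<cdot> f y)"
  have "expansion Z (\<Sum>y\<in>S. tau (tau (u y)) \<cdot> y)"
    unfolding Z_def using expansion_f by (intro expansion_sum expansion_scale) auto
  moreover have "coeff Z e = (\<Sum>y\<in>S. if y = x then tau (u x) else 0)"
    unfolding Z_def coeff_sum using expansion_f by (intro sum.cong) auto
  ultimately show ?thesis using that[of Z] assms(2,3) by simp
qed

lemma isolates_eq_0:
  assumes "isolates e x S" "finite S" "x \<in> S" and zero: "(\<Sum>y\<in>S. u y \<cdot> y) = 0"
  shows "u x = 0"
proof -
  obtain Z where expansion_Z: "expansion Z (\<Sum>y\<in>S. u y \<cdot> y)" "coeff Z e = tau (u x)"
    by (rule isolates_coeff[OF assms(1-3)])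
  then have "Z = 0" using zero expansion_zero expansion_left_unique by metis
  with expansion_Z(2) show ?thesis by simp
qed

lemma isolates_nonneg:
  assumes "isolates e x S" "finite S" "x \<in> S" and "positive (qtorus_of (\<Sum>y\<in>S. u y \<cdot> y))"
  shows "lpoly_nonneg (u x)"
proof -
  obtain Z where "expansion Z (\<Sum>y\<in>S. u y \<cdot> y)" "coeff Z e = tau (u x)"
    by (rule isolates_coeff[OF assms(1-3)])
  then have "lpoly_nonneg (tau (u x))"
    using nonneg_coeffs_expansion[OF assms(4)] by (metis nonneg_coeffs_def)
  then have "lpoly_nonneg (tau (tau (u x)))" by (rule lpoly_nonneg_tau)
  then show ?thesis by simp
qed

lemma isolates_cluster_mon:
  assumes expansion_x: "expansion (cluster_mon 1 i j) x" and "S \<subseteq> basis"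
  shows "isolates (int i, int j) x S"
  unfolding isolates_def
proof
  fix y assume "y \<in> S"
  then obtain Z where expansion_Z: "Z \<in> basis" "expansion Z y"
    using assms(2) expansion_basis by blast
  have "Z = Xmon (int i, int j) \<longleftrightarrow> y = x"
    using expansion_Z(2) expansion_x expansion_left_unique expansion_right_unique unfolding cluster_mon_1 by blast
  then have "coeff Z (int i, int j) = (if y = x then 1 else 0)"
    using coeff_basis_quadrant[OF expansion_Z(1)] by (auto simp: coeff_Xmon)
  then show "\<exists>Z. expansion Z y \<and> coeff Z (int i, int j) = (if y = x then 1 else 0)"
    using expansion_Z(2) by blast
qed

lemma isolates_chebyshev:
  assumes "s = 1" "n \<ge> 1"
    and S_cases: "\<And>y. y \<in> S \<Longrightarrow> (\<exists>m a b. m - c \<le> -1 \<and> y = cluster_mon m a b) \<or> (\<exists>k\<ge>1. y = chebyshev k X_delta)"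
  shows "isolates (- int n, 2 * int n) (chebyshev n X_delta) S"
  unfolding isolates_def
proof
  let ?e = "(- int n, 2 * int n)"
  fix y assume "y \<in> S"
  have coeff_self: "coeff (chebyshev n X_delta) ?e = 1"
    using assms(2) by (simp add: coeff_chebyshev_X_delta_ray)
  have expansion_self: "expansion (chebyshev k X_delta) (chebyshev k X_delta)" for k
    by (intro expansion_chebyshev expansion_X_delta)
  from S_cases[OF \<open>y \<in> S\<close>] show "\<exists>Z. expansion Z y \<and> coeff Z ?e = (if y = chebyshev n X_delta then 1 else 0)"
  proof (elim disjE exE conjE)
    fix m a b assume m_bound: "m - c \<le> -1" and y_eq: "y = cluster_mon m a b"
    have expansion_Z: "expansion (cluster_mon (m - c) a b) y" "coeff (cluster_mon (m - c) a b) ?e = 0"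
      using expansion_cluster_mon(1)[OF assms(1)] coeff_cluster_mon_ray[OF m_bound assms(2)] by (simp_all add: y_eq)
    moreover have "y \<noteq> chebyshev n X_delta"
      using expansion_Z coeff_self expansion_self[of n] expansion_left_unique by (metis zero_neq_one)
    ultimately show ?thesis by auto
  next
    fix k assume k_ge_1: "k \<ge> 1" and y_eq: "y = chebyshev k X_delta"
    have "coeff y ?e = (if k = n then 1 else 0)"
      using assms(2) k_ge_1 by (simp add: y_eq coeff_chebyshev_X_delta_ray)
    moreover from this have "k = n" if "y = chebyshev n X_delta"
      using coeff_self that by (auto split: if_splits)
    ultimately show ?thesis using expansion_self[of k] y_eq by auto
  qed
qed

end

lemma cluster_mon_isolated:
  assumes "S \<subseteq> basis"
  obtains c s e where "cluster_symmetry c s" "cluster_symmetry.isolates c s e (cluster_mon m a b) S"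
proof (cases "even m")
  case True
  then interpret cluster_symmetry "m + 2" "-1" by unfold_locales auto
  have "expansion (cluster_mon 1 b a) (cluster_mon m a b)"
    using expansion_cluster_mon(2)[of m b a] by simp
  then show ?thesis
    using that isolates_cluster_mon[OF _ assms] cluster_symmetry_axioms by blast
next
  case False
  then interpret cluster_symmetry "m - 1" 1 by unfold_locales auto
  have "expansion (cluster_mon 1 a b) (cluster_mon m a b)"
    using expansion_cluster_mon(1)[of m a b] by simp
  then show ?thesis
    using that isolates_cluster_mon[OF _ assms] cluster_symmetry_axioms by blast
qed

lemma chebyshev_isolated:
  assumes "finite S" "S \<subseteq> basis" "n \<ge> 1"
  obtains c s e where "cluster_symmetry c s" "cluster_symmetry.isolates c s e (chebyshev n X_delta) S"
proof -
  obtain idx where idx: "\<And>y. y \<in> S \<Longrightarrow>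
      (\<exists>a b. y = cluster_mon (idx y) a b) \<or> (\<exists>k\<ge>1. y = chebyshev k X_delta)"
    using assms(2) by (metis basis_cases subsetD)
  define c where "c = 2 * (\<bar>Max (idx ` S)\<bar> + 1)"
  interpret cluster_symmetry c 1 by unfold_locales (simp_all add: c_def)
  have "idx y - c \<le> -1" if "y \<in> S" for y
  proof -
    have "idx y \<le> Max (idx ` S)" using assms(1) that by simp
    then show ?thesis unfolding c_def by arith
  qed
  then have "isolates (- int n, 2 * int n) (chebyshev n X_delta) S"
    using idx by (intro isolates_chebyshev \<open>n \<ge> 1\<close>) blast+
  then show ?thesis using that cluster_symmetry_axioms by blast
qed

theorem basis_isolated:
  assumes "finite S" "S \<subseteq> basis" "x \<in> S"
  obtains c s e where "cluster_symmetry c s" "cluster_symmetry.isolates c s e x S"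
proof -
  have "x \<in> basis" using assms(2,3) by blast
  then show ?thesis
    using that cluster_mon_isolated[OF assms(2)] chebyshev_isolated[OF assms(1,2)]
    by (cases rule: basis_cases) metis+
qed

theorem independent_basis: "torus.independent basis"
proof
  assume "torus.dependent basis"
  then obtain S u x where relation: "finite S" "S \<subseteq> basis" "(\<Sum>y\<in>S. u y \<cdot> y) = 0" "x \<in> S" "u x \<noteq> 0"
    by (auto simp: torus.dependent_explicit)
  obtain c s e where "cluster_symmetry c s" "cluster_symmetry.isolates c s e x S"
    using relation(1,2,4) by (rule basis_isolated)
  then show False using cluster_symmetry.isolates_eq_0 relation by blast
qed

theorem positive_coefficients_nonneg:
  assumes "positive (qtorus_of (\<Sum>y\<in>S. u y \<cdot> y))" "finite S" "S \<subseteq> basis" "x \<in> S"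
  shows "lpoly_nonneg (u x)"
proof -
  obtain c s e where "cluster_symmetry c s" "cluster_symmetry.isolates c s e x S"
    using assms(2-4) by (rule basis_isolated)
  then show ?thesis using cluster_symmetry.isolates_nonneg assms by blast
qed

lemma Aq_eq: "Aq = qtorus_of ` cluster_algebra"
  by (auto simp: cluster_algebra_def image_iff) (metis UNIV_I torus_of_inverse)

lemma inj_qtorus_of: "inj qtorus_of"
  by (simp add: inj_def qtorus_of_inject)

theorem positive_nonneg_combination:
  assumes "positive Y"
  obtains S c where "finite S" "S \<subseteq> Bset" "\<forall>b\<in>S. lpoly_nonneg (c b)" "Y = (\<Sum>b\<in>S. tsmul (c b) b)"
proof -
  from assms obtain y where "y \<in> torus.span basis" and Y_eq: "Y = qtorus_of y"
    unfolding positive_def Aq_eq span_basis by blast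
  then obtain S u where combination: "finite S" "S \<subseteq> basis" "y = (\<Sum>x\<in>S. u x \<cdot> x)"
    by (auto simp: torus.span_explicit)
  then have "lpoly_nonneg (u x)" if "x \<in> S" for x
    using assms that unfolding Y_eq by (intro positive_coefficients_nonneg) auto
  moreover have "Y = (\<Sum>b\<in>qtorus_of ` S. tsmul (u (torus_of b)) b)"
    by (simp add: Y_eq combination(3) sum.reindex inj_on_subset[OF inj_qtorus_of] qtorus_of_inverse
        qtorus_of_sum scale.rep_eq)
  ultimately show ?thesis
    using combination(1,2) by (intro that[of "qtorus_of ` S" "\<lambda>b. u (torus_of b)"])
      (auto simp: Bset_eq qtorus_of_inverse)
qed

interpretation qtorus: module tsmul
proof
  fix a b :: lpoly and x y :: qtorus
  show "tsmul a (x + y) = tsmul a x + tsmul a y" by (rule tsmul_add_right)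
  show "tsmul (a + b) x = tsmul a x + tsmul b x"
    by (simp add: tsmul_def single_add tmult_add_left)
  show "tsmul a (tsmul b x) = tsmul (a * b) x" "tsmul 1 x = x"
    by (intro poly_mapping_eqI; simp add: lookup_tsmul mult.assoc)+
qed

interpretation qtorus_of: module_hom scale tsmul qtorus_of
  by unfold_locales (simp_all add: plus_torus.rep_eq scale.rep_eq)

theorem theorem3p7:
  shows "Bset \<subseteq> Aq \<and> module.span tsmul Bset = Aq \<and> \<not> module.dependent tsmul Bset \<and>
         (\<forall>Y. positive Y \<longrightarrow>
            (\<exists>S c. finite S \<and> S \<subseteq> Bset \<and> (\<forall>b\<in>S. lpoly_nonneg (c b)) \<and>
                   Y = (\<Sum>b\<in>S. tsmul (c b) b)))"
proof (intro conjI allI impI)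
  show "Bset \<subseteq> Aq"
    unfolding Bset_eq Aq_eq by (intro image_mono basis_subset_cluster_algebra)
  show "qtorus.span Bset = Aq"
    unfolding Bset_eq Aq_eq qtorus_of.span_image span_basis ..
  show "\<not> qtorus.dependent Bset"
    unfolding Bset_eq using independent_basis inj_qtorus_of by (rule qtorus_of.independent_inj_image)
  fix Y assume "positive Y"
  then show "\<exists>S c. finite S \<and> S \<subseteq> Bset \<and> (\<forall>b\<in>S. lpoly_nonneg (c b)) \<and> Y = (\<Sum>b\<in>S. tsmul (c b) b)"
    by (rule positive_nonneg_combination) blast
qed

end
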